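(* For every $p\in\mathbb{R}^d$, the effective Hamiltonian $H(p)$ of first-passage percolation is given by $$H(p)=\inf_{\phi\in S}\ \operatorname*{ess\,sup}_{\omega\in\Omega}\ \sup_{x\in\mathbb{Z}^d}\ \mathcal{H}(\phi,p,x,\omega).$$
   Context: Let $d\ge 1$, let $e_1,\dots,e_d$ be the canonical basis of $\mathbb{Z}^d$ and $A=\{\pm e_1,\dots,\pm e_d\}$. Let $(\Omega,\mathcal{F},\mathbb{P})$ be a probability space with a family of invertible measure-preserving maps $\{V^x:\Omega\to\Omega\}_{x\in\mathbb{Z}^d}$ satisfying $V^{x+y}=V^x\circ V^y$. A set $B\in\mathcal{F}$ is invariant if $V^yB=B$ for every $y\in\mathbb{Z}^d\setminus\{0\}$; the family is ergodic if every invariant set has probability $0$ or $1$, and this is assumed. Edge weights: $\tau:\mathbb{Z}^d\times A\times\Omega\to\mathbb{R}$, where $\tau(x,\alpha,\omega)$ is the weight of the edge from $x$ to $x+\alpha$, satisfies: (i) $0<a=\operatorname{ess\,inf}_{x,\alpha,\omega}\tau$ and $b=\operatorname{ess\,sup}_{x,\alpha,\omega}\tau<\infty$; (ii) stationarity: $\tau(x+y,\alpha,\omega)=\tau(x,\alpha,V^y\omega)$; (iii) undirectedness: $\tau(x,\alpha,\omega)=\tau(x+\alpha,-\alpha,\omega)$. A path from $x$ to $y$ is a finite sequence of vertices $x=v_0,\dots,v_n=y$ of $\mathbb{Z}^d$ with consecutive vertices nearest neighbors; its weight is $W(\gamma)=\sum_{i=0}^{n-1}\tau(v_i,v_{i+1}-v_i)$.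 The first-passage time is $T(x,y)=\inf W(\gamma)$ over paths from $x$ to $y$, and $T(x)=T(x,0)$. The time constant is $m(x)=\lim_{n\to\infty}T([nx])/n$ for $x\in\mathbb{R}^d$, where $[nx]$ is the lattice point closest to $nx$ (fixed tie-breaking); the limit exists almost surely and is deterministic, and $m$ is a norm. The effective Hamiltonian is the dual norm $H(p)=\sup_{m(x)=1}p\cdot x$. Discrete derivative: $\mathcal{D}_\alpha\phi(x)=\phi(x+\alpha)-\phi(x)$ for $\alpha\in A$, and $\mathcal{D}\phi=\{\mathcal{D}_\alpha\phi\}_{\alpha\in A}$. Discrete Hamiltonian: $$\mathcal{H}(\phi,p,x,\omega)=\sup_{\alpha\in A}\left\{\frac{-\mathcal{D}_\alpha\phi(x,\omega)-p\cdot\alpha}{\tau(x,\alpha,\omega)}\right\}.$$ $S$ is the set of functions $\phi:\mathbb{Z}^d\times\Omega\to\mathbb{R}$ (with $\mathcal{D}_\alpha\phi(x,\cdot)$ measurable) such that $\mathcal{D}\phi(x+z,\omega)=\mathcal{D}\phi(x,V^z\omega)$ for all $x,z\in\mathbb{Z}^d$, and $\|\mathcal{D}_\alpha\phi(0,\cdot)\|_{L^\infty(\Omega)}<\infty$ and $\mathbb{E}[\mathcal{D}_\alpha\phi(0,\cdot)]=0$ for all $\alpha\in A$. *)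

theory Defs
  imports "HOL-Probability.Probability"
begin

section \<open>The lattice\<close>

text \<open>The lattice is \<^typ>\<open>int ^ 'd\<close> with \<^typ>\<open>'d\<close> a finite (nonempty) index type,
  sitting in \<^typ>\<open>real ^ 'd\<close>.\<close>

definition real_vec :: "int ^ 'd \<Rightarrow> real ^ 'd"
  where "real_vec x = (\<chi> i. real_of_int (x $ i))"

definition steps :: "(int ^ 'd) set"
  where "steps = range (\<lambda>i. axis i 1) \<union> range (\<lambda>i. - axis i 1)"

text \<open>The closest lattice point. Ties are broken coordinatewise by \<^const>\<open>round\<close>, that is, upwards.\<close>

definition nearest_lattice_point :: "real ^ 'd \<Rightarrow> int ^ 'd"
  where "nearest_lattice_point y = (\<chi> i. round (y $ i))"

lemma nearest_lattice_point_closest: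
  "dist y (real_vec (nearest_lattice_point y)) \<le> dist y (real_vec z)"
  unfolding dist_norm
  by (rule norm_le_componentwise_cart)
     (simp add: real_vec_def nearest_lattice_point_def round_diff_minimal)


section \<open>The random environment\<close>

definition essinf :: "'a measure \<Rightarrow> ('a \<Rightarrow> ereal) \<Rightarrow> ereal"
  where "essinf M f = - esssup M (\<lambda>x. - f x)"

text \<open>Invertibility of the measurable maps \<open>V x\<close> is bijectivity on \<open>space M\<close>: the group law makes
  \<open>V (- x)\<close> the inverse of \<open>V x\<close>, so the inverse is measurable as well.\<close>

locale ergodic_action = prob_space M
  for M :: "'w measure" +
  fixes V :: "int ^ 'd \<Rightarrow> 'w \<Rightarrow> 'w"
  assumes invertible: "bij_betw (V x) (space M) (space M)"
    and measurable_V: "V x \<in> measurable M M"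
    and measure_preserving: "distr M M (V x) = M"
    and group_law: "\<omega> \<in> space M \<Longrightarrow> V (x + y) \<omega> = V x (V y \<omega>)"
    and ergodic: "\<lbrakk>B \<in> sets M; \<forall>y. y \<noteq> 0 \<longrightarrow> V y ` B = B\<rbrakk> \<Longrightarrow> prob B = 0 \<or> prob B = 1"

text \<open>\<open>\<tau> x \<alpha> \<omega>\<close> is the weight of the edge from \<open>x\<close> to \<open>x + \<alpha>\<close>; only its values at \<open>\<alpha> \<in> steps\<close> matter.
  The essential bounds are jointly in \<open>(x, \<alpha>, \<omega>)\<close>, hence with respect to the product of
  counting measure and \<open>M\<close>.\<close>

locale first_passage_percolation = ergodic_action M V
  for M :: "'w measure" and V :: "int ^ 'd \<Rightarrow> 'w \<Rightarrow> 'w" +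
  fixes \<tau> :: "int ^ 'd \<Rightarrow> int ^ 'd \<Rightarrow> 'w \<Rightarrow> real"
  assumes measurable_weight: "\<alpha> \<in> steps \<Longrightarrow> \<tau> x \<alpha> \<in> borel_measurable M"
    and essinf_pos:
      "0 < essinf (count_space (UNIV \<times> steps) \<Otimes>\<^sub>M M) (\<lambda>((x, \<alpha>), \<omega>). ereal (\<tau> x \<alpha> \<omega>))"
    and esssup_finite:
      "esssup (count_space (UNIV \<times> steps) \<Otimes>\<^sub>M M) (\<lambda>((x, \<alpha>), \<omega>). ereal (\<tau> x \<alpha> \<omega>)) < \<infinity>"
    and stationary:
      "\<lbrakk>\<alpha> \<in> steps; \<omega> \<in> space M\<rbrakk> \<Longrightarrow> \<tau> (x + y) \<alpha> \<omega> = \<tau> x \<alpha> (V y \<omega>)"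
    and undirected:
      "\<lbrakk>\<alpha> \<in> steps; \<omega> \<in> space M\<rbrakk> \<Longrightarrow> \<tau> x \<alpha> \<omega> = \<tau> (x + \<alpha>) (- \<alpha>) \<omega>"


section \<open>First-passage time, time constant and effective Hamiltonian\<close>

definition paths :: "int ^ 'd \<Rightarrow> int ^ 'd \<Rightarrow> (int ^ 'd) list set"
  where "paths x y = {\<gamma>. \<gamma> \<noteq> [] \<and> hd \<gamma> = x \<and> last \<gamma> = y \<and>
    (\<forall>i. Suc i < length \<gamma> \<longrightarrow> \<gamma> ! Suc i - \<gamma> ! i \<in> steps)}"

definition path_weight ::
  "(int ^ 'd \<Rightarrow> int ^ 'd \<Rightarrow> 'w \<Rightarrow> real) \<Rightarrow> 'w \<Rightarrow> (int ^ 'd) list \<Rightarrow> real"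
  where "path_weight \<tau> \<omega> \<gamma> = (\<Sum>i<length \<gamma> - 1. \<tau> (\<gamma> ! i) (\<gamma> ! Suc i - \<gamma> ! i) \<omega>)"

definition passage_time ::
  "(int ^ 'd \<Rightarrow> int ^ 'd \<Rightarrow> 'w \<Rightarrow> real) \<Rightarrow> int ^ 'd \<Rightarrow> int ^ 'd \<Rightarrow> 'w \<Rightarrow> real"
  where "passage_time \<tau> x y \<omega> = (INF \<gamma>\<in>paths x y. path_weight \<tau> \<omega> \<gamma>)"

text \<open>The deterministic value of the almost sure limit.\<close>

definition time_constant ::
  "'w measure \<Rightarrow> (int ^ 'd \<Rightarrow> int ^ 'd \<Rightarrow> 'w \<Rightarrow> real) \<Rightarrow> real ^ 'd \<Rightarrow> real"
  where "time_constant M \<tau> x = (THE c. AE \<omega> in M.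
    (\<lambda>n. passage_time \<tau> (nearest_lattice_point (real n *\<^sub>R x)) 0 \<omega> / real n) \<longlonglongrightarrow> c)"

definition effective_hamiltonian ::
  "'w measure \<Rightarrow> (int ^ 'd \<Rightarrow> int ^ 'd \<Rightarrow> 'w \<Rightarrow> real) \<Rightarrow> real ^ 'd \<Rightarrow> real"
  where "effective_hamiltonian M \<tau> p = (SUP x\<in>{x. time_constant M \<tau> x = 1}. p \<bullet> x)"


section \<open>The discrete Hamiltonian and its test functions\<close>

definition discrete_deriv ::
  "int ^ 'd \<Rightarrow> (int ^ 'd \<Rightarrow> 'w \<Rightarrow> real) \<Rightarrow> int ^ 'd \<Rightarrow> 'w \<Rightarrow> real"
  where "discrete_deriv \<alpha> \<phi> x \<omega> = \<phi> (x + \<alpha>) \<omega> - \<phi> x \<omega>"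

definition discrete_hamiltonian ::
  "(int ^ 'd \<Rightarrow> int ^ 'd \<Rightarrow> 'w \<Rightarrow> real) \<Rightarrow> (int ^ 'd \<Rightarrow> 'w \<Rightarrow> real) \<Rightarrow> real ^ 'd
    \<Rightarrow> int ^ 'd \<Rightarrow> 'w \<Rightarrow> real"
  where "discrete_hamiltonian \<tau> \<phi> p x \<omega> =
    (SUP \<alpha>\<in>steps. (- discrete_deriv \<alpha> \<phi> x \<omega> - p \<bullet> real_vec \<alpha>) / \<tau> x \<alpha> \<omega>)"

definition test_functions ::
  "'w measure \<Rightarrow> (int ^ 'd \<Rightarrow> 'w \<Rightarrow> 'w) \<Rightarrow> (int ^ 'd \<Rightarrow> 'w \<Rightarrow> real) set"
  where "test_functions M V = {\<phi>.
    (\<forall>\<alpha>\<in>steps. \<forall>x. discrete_deriv \<alpha> \<phi> x \<in> borel_measurable M) \<and>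
    (\<forall>\<alpha>\<in>steps. \<forall>x z. \<forall>\<omega>\<in>space M.
      discrete_deriv \<alpha> \<phi> (x + z) \<omega> = discrete_deriv \<alpha> \<phi> x (V z \<omega>)) \<and>
    (\<forall>\<alpha>\<in>steps. esssup M (\<lambda>\<omega>. ereal \<bar>discrete_deriv \<alpha> \<phi> 0 \<omega>\<bar>) < \<infinity>) \<and>
    (\<forall>\<alpha>\<in>steps. integral\<^sup>L M (discrete_deriv \<alpha> \<phi> 0) = 0)}"

end

(*
  Let K be the set of slopes p for which some test function phi makes psi(x) = phi(x) + p.x
  1-Lipschitz for the passage time T. By scaling, the right-hand side is the gauge of K, so by
  convex duality it remains to identify the time constant with the support function of K.
  Subadditivity and stationarity give p.z <= E T(nz,0)/n for all p in K. Conversely, Busemann-type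
  increments T(y,s) - T(0,s), averaged over targets s that run off in direction -z, are nearly
  stationary cocycles with mean at z at least inf E T(nz,0)/n; a strong L2 limit of midpoint
  combinations is an exact cocycle F, whose mean is an element of K. The maximal ergodic inequality
  bounds limsup T(nz,0)/n from above by E T(z,0); applied to F it bounds the liminf from below.
*)

theory Submission
  imports Defs
begin

section \<open>The lattice\<close>

text \<open>Two obstacles shape the argument. First, only the whole group of shifts is ergodic; a
  single \<open>V z\<close> need not be, so averages of a cocycle along multiples of z need not have
  a constant limit. The upper and lower limits of T(nz,0)/n avoid this: moving both endpoints by a
  fixed y changes T by a bounded amount, so these limits are invariant under all shifts, hence
  almost surely constant, and a maximal inequality for the one map \<open>V z\<close> suffices to
  compare the constants with means. Second, subadditivity helps only with upper bounds; a lower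
  bound needs a truly additive process below T, which an exact stationary cocycle provides. Averaged
  increments are cocycles only up to an error, so a limit is taken; almost sure convergence carries
  all pointwise constraints to it, and stability of the constraints under midpoints suffices to
  obtain such convergence. The targets run along -z because the mean of T(z,-jz) - T(0,-jz) is E
  T((j+1)z,0) - E T(jz,0), a telescoping difference. Finally, \<open>K\<close> is not shown to be
  closed, so the duality leaves room through strict inequalities.\<close>

lemma real_vec_0 [simp]: "real_vec 0 = 0"
  by (simp add: real_vec_def vec_eq_iff)

lemma real_vec_add: "real_vec (x + y) = real_vec x + real_vec y"
  by (simp add: real_vec_def vec_eq_iff)

lemma real_vec_minus: "real_vec (- x) = - real_vec x"
  by (simp add: real_vec_def vec_eq_iff)

lemma real_vec_diff: "real_vec (x - y) = real_vec x - real_vec y"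
  by (simp add: real_vec_def vec_eq_iff)

lemma real_vec_scale: "real_vec (n *s x) = of_int n *\<^sub>R real_vec x"
  by (simp add: real_vec_def vec_eq_iff)

lemma real_vec_axis: "real_vec (axis i 1) = axis i 1"
  by (simp add: real_vec_def axis_def vec_eq_iff)

lemma finite_steps [simp]: "finite steps"
  by (simp add: steps_def)

lemma axis_in_steps [simp]: "axis i 1 \<in> steps" "- axis i 1 \<in> steps"
  by (auto simp: steps_def)

lemma steps_nonempty [simp]: "steps \<noteq> {}"
  by (simp add: steps_def)

lemma uminus_steps: "\<alpha> \<in> steps \<Longrightarrow> - \<alpha> \<in> steps"
  by (auto simp: steps_def)

lemma norm_real_vec_steps:
  fixes \<alpha> :: "int ^ 'd"
  shows "\<alpha> \<in> steps \<Longrightarrow> norm (real_vec \<alpha>) = 1"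
  by (auto simp: steps_def real_vec_minus real_vec_axis)

definition l1 :: "int ^ 'd \<Rightarrow> nat"
  where "l1 x = (\<Sum>i\<in>UNIV. nat \<bar>x $ i\<bar>)"

lemma l1_0 [simp]: "l1 0 = 0"
  by (simp add: l1_def)

lemma l1_minus [simp]: "l1 (- x) = l1 x"
  by (simp add: l1_def)

lemma l1_le_norm: "real (l1 (x :: int ^ 'd)) \<le> real CARD('d) * norm (real_vec x)"
proof -
  have "real (l1 x) = (\<Sum>i\<in>UNIV. \<bar>real_vec x $ i\<bar>)"
    by (simp add: l1_def real_vec_def)
  also have "\<dots> \<le> (\<Sum>i\<in>(UNIV :: 'd set). norm (real_vec x))"
    by (intro sum_mono component_le_norm_cart)
  finally show ?thesis by simp
qed

lemma l1_predecessor: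
  fixes x :: "int ^ 'd"
  assumes "x \<noteq> 0"
  obtains \<alpha> where "\<alpha> \<in> steps" "l1 x = Suc (l1 (x - \<alpha>))"
proof -
  obtain i where i: "x $ i \<noteq> 0"
    using assms by (auto simp: vec_eq_iff)
  define \<alpha> :: "int ^ 'd" where "\<alpha> = (if x $ i > 0 then axis i 1 else - axis i 1)"
  have ai: "\<alpha> $ i = (if x $ i > 0 then 1 else - 1)" and aj: "\<And>j. j \<noteq> i \<Longrightarrow> \<alpha> $ j = 0"
    by (auto simp: \<alpha>_def axis_def)
  have "l1 x = nat \<bar>x $ i\<bar> + (\<Sum>j\<in>UNIV - {i}. nat \<bar>x $ j\<bar>)"
    unfolding l1_def by (rule sum.remove) auto
  moreover have "l1 (x - \<alpha>) = nat \<bar>(x - \<alpha>) $ i\<bar> + (\<Sum>j\<in>UNIV - {i}. nat \<bar>(x - \<alpha>) $ j\<bar>)"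
    unfolding l1_def by (rule sum.remove) auto
  moreover have "(\<Sum>j\<in>UNIV - {i}. nat \<bar>(x - \<alpha>) $ j\<bar>) = (\<Sum>j\<in>UNIV - {i}. nat \<bar>x $ j\<bar>)"
    by (rule sum.cong) (auto simp: aj)
  moreover have "nat \<bar>x $ i\<bar> = Suc (nat \<bar>(x - \<alpha>) $ i\<bar>)"
    using i ai by auto
  ultimately have "l1 x = Suc (l1 (x - \<alpha>))" by simp
  moreover have "\<alpha> \<in> steps" by (simp add: \<alpha>_def)
  ultimately show ?thesis by (intro that)
qed

text \<open>Induction along a shortest lattice path from 0. The clause on \<open>l1\<close> records
  that every step raises the distance by exactly one, as bounds linear in \<open>l1\<close>
  require.\<close>

lemma lattice_induct [case_names zero step]:
  fixes x :: "int ^ 'd"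
  assumes "P 0"
    and "\<And>x \<alpha>. \<alpha> \<in> steps \<Longrightarrow> l1 (x + \<alpha>) = Suc (l1 x) \<Longrightarrow> P x \<Longrightarrow> P (x + \<alpha>)"
  shows "P x"
proof (induction "l1 x" arbitrary: x)
  case 0
  then show ?case using assms(1) l1_predecessor[of x] by fastforce
next
  case (Suc n)
  then have "x \<noteq> 0" by auto
  then obtain \<alpha> where "\<alpha> \<in> steps" "l1 x = Suc (l1 (x - \<alpha>))"
    by (rule l1_predecessor)
  then show ?case using Suc assms(2)[of \<alpha> "x - \<alpha>"] by simp
qed

lemma additive_imp_inner:
  fixes f :: "int ^ 'd \<Rightarrow> real"
  assumes add: "\<And>x y. f (x + y) = f x + f y"
  shows "f x = (\<chi> i. f (axis i 1)) \<bullet> real_vec x"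
proof (induction x rule: lattice_induct)
  case zero
  then show ?case using add[of 0 0] by simp
next
  case (step x \<alpha>)
  let ?q = "(\<chi> i. f (axis i 1)) :: real ^ 'd"
  have "f (- axis i 1) = - f (axis i 1)" for i
    using add[of "axis i 1" "- axis i 1"] add[of 0 0] by simp
  then have "f \<alpha> = ?q \<bullet> real_vec \<alpha>"
    using step(1) by (auto simp: steps_def real_vec_axis real_vec_minus inner_axis)
  then show ?case
    by (simp add: add step real_vec_add inner_add_right)
qed

lemma norm_nearest_lattice_point:
  fixes x :: "real ^ 'd"
  shows "norm (real_vec (nearest_lattice_point x) - x) \<le> real CARD('d)"
proof -
  have "norm (real_vec (nearest_lattice_point x) - x)
      \<le> (\<Sum>i\<in>UNIV. \<bar>(real_vec (nearest_lattice_point x) - x) $ i\<bar>)"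
    by (rule norm_le_l1_cart)
  also have "\<dots> \<le> (\<Sum>i\<in>(UNIV :: 'd set). 1)"
  proof (rule sum_mono)
    fix i
    show "\<bar>(real_vec (nearest_lattice_point x) - x) $ i\<bar> \<le> 1"
      using of_int_round_abs_le[of "x $ i"]
      by (simp add: real_vec_def nearest_lattice_point_def)
  qed
  finally show ?thesis by simp
qed

text \<open>Cut the box into lines in direction \<open>k\<close>. On each line the shifted minus the
  unshifted sum telescopes to two end terms, each at most \<open>C\<close> in absolute value, and
  there are \<open>card B / R\<close> lines.\<close>

lemma box_average_step:
  fixes g :: "int ^ 'd \<Rightarrow> real" and R :: int
  assumes R: "R > 0" and g: "\<And>x. \<bar>g x\<bar> \<le> C"
  defines "B \<equiv> {u :: int ^ 'd. \<forall>i. 0 \<le> u $ i \<and> u $ i < R}"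
  shows "\<bar>(\<Sum>u\<in>B. g (u + axis k 1)) - (\<Sum>u\<in>B. g u)\<bar> \<le> 2 * C * real (card B) / of_int R"
    and "finite B" and "B \<noteq> {}"
proof -
  show fin: "finite B"
  proof (rule finite_surj)
    show "finite (PiE UNIV (\<lambda>_ :: 'd. {0..<R}))" by (intro finite_PiE) auto
    show "B \<subseteq> vec_lambda ` PiE UNIV (\<lambda>_. {0..<R})"
    proof
      fix u assume "u \<in> B"
      then show "u \<in> vec_lambda ` PiE UNIV (\<lambda>_. {0..<R})"
        by (intro image_eqI[of _ _ "vec_nth u"]) (auto simp: B_def)
    qed
  qed
  have "0 \<in> B" using R by (simp add: B_def)
  then show "B \<noteq> {}" by auto
  define B0 where "B0 = {u\<in>B. u $ k = 0}"
  have bij: "bij_betw (\<lambda>(u, j). u + of_nat j *s axis k 1) (B0 \<times> {..<nat R}) B"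
    by (rule bij_betw_byWitness[where f' = "\<lambda>u. (u - (u $ k) *s axis k 1, nat (u $ k))"])
      (use R in \<open>auto simp: B_def B0_def vec_eq_iff axis_def\<close>)
  have line: "(\<Sum>u\<in>B. h u) = (\<Sum>u\<in>B0. \<Sum>j<nat R. h (u + of_nat j *s axis k 1))"
    for h :: "int ^ 'd \<Rightarrow> real"
    using sum.reindex_bij_betw[OF bij, of h]
    by (simp add: sum.cartesian_product split_beta)
  have card: "real (card B) = of_int R * real (card B0)"
    using arg_cong[OF bij_betw_same_card[OF bij], of real] R by (simp add: card_cartesian_product mult_ac)
  have shift: "u + of_nat j *s axis k 1 + axis k 1 = u + of_nat (Suc j) *s axis k 1"
    for u :: "int ^ 'd" and j
    by (simp add: vec_eq_iff axis_def)
  have "(\<Sum>u\<in>B. g (u + axis k 1)) - (\<Sum>u\<in>B. g u)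
     = (\<Sum>u\<in>B0. \<Sum>j<nat R. g (u + of_nat (Suc j) *s axis k 1) - g (u + of_nat j *s axis k 1))"
    unfolding line shift by (simp add: sum_subtractf)
  also have "\<dots> = (\<Sum>u\<in>B0. g (u + of_nat (nat R) *s axis k 1) - g (u + of_nat 0 *s axis k 1))"
    by (intro sum.cong refl sum_lessThan_telescope)
  finally have "\<bar>(\<Sum>u\<in>B. g (u + axis k 1)) - (\<Sum>u\<in>B. g u)\<bar>
     \<le> (\<Sum>u\<in>B0. \<bar>g (u + of_nat (nat R) *s axis k 1) - g (u + of_nat 0 *s axis k 1)\<bar>)"
    by (simp only: sum_abs)
  also have "\<dots> \<le> (\<Sum>u\<in>B0. 2 * C)"
  proof (rule sum_mono)
    fix u
    show "\<bar>g (u + of_nat (nat R) *s axis k 1) - g (u + of_nat 0 *s axis k 1)\<bar> \<le> 2 * C"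
      using g[of "u + of_nat (nat R) *s axis k 1"] g[of "u + of_nat 0 *s axis k 1"] by linarith
  qed
  also have "\<dots> = 2 * C * real (card B) / of_int R"
    using R by (simp add: card)
  finally show "\<bar>(\<Sum>u\<in>B. g (u + axis k 1)) - (\<Sum>u\<in>B. g u)\<bar> \<le> 2 * C * real (card B) / of_int R" .
qed

text \<open>\<open>B\<close> is fixed before \<open>g\<close>, \<open>C\<close> and
  \<open>w\<close>, since one box must later serve all targets, environments and shifts. The factor
  \<open>l1 w\<close> counts the unit steps of a lattice path to \<open>w\<close>.\<close>

lemma box_average:
  fixes R :: nat
  assumes "R > 0"
  obtains B :: "(int ^ 'd) set" where "finite B" "B \<noteq> {}"
    "\<And>(g :: int ^ 'd \<Rightarrow> real) C w. (\<And>x. \<bar>g x\<bar> \<le> C) \<Longrightarrow>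
      \<bar>(\<Sum>u\<in>B. g (u + w)) - (\<Sum>u\<in>B. g u)\<bar> \<le> 2 * C * real (l1 w) * real (card B) / real R"
proof
  let ?B = "{u :: int ^ 'd. \<forall>i. 0 \<le> u $ i \<and> u $ i < int R}"
  show "finite ?B" "?B \<noteq> {}"
    using box_average_step(2,3)[of "int R" "\<lambda>_. 0" 0] assms by auto
  fix g :: "int ^ 'd \<Rightarrow> real" and C w
  assume g: "\<And>x. \<bar>g x\<bar> \<le> C"
  let ?e = "2 * C * real (card ?B) / real R"
  have unit: "\<bar>(\<Sum>u\<in>?B. h (u + \<alpha>)) - (\<Sum>u\<in>?B. h u)\<bar> \<le> ?e"
    if \<alpha>: "\<alpha> \<in> steps" and h: "\<And>x. \<bar>h x\<bar> \<le> C" for h :: "int ^ 'd \<Rightarrow> real" and \<alpha>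
  proof -
    consider k where "\<alpha> = axis k 1" | k where "\<alpha> = - axis k 1"
      using \<alpha> by (auto simp: steps_def)
    then show ?thesis
    proof cases
      case 1
      then show ?thesis using box_average_step(1)[of "int R" h C k] assms h by simp
    next
      case 2
      then show ?thesis
        using box_average_step(1)[of "int R" "\<lambda>u. h (u - axis k 1)" C k] assms h
        by (simp add: abs_minus_commute)
    qed
  qed
  have "\<bar>(\<Sum>u\<in>?B. g (u + w)) - (\<Sum>u\<in>?B. g u)\<bar> \<le> real (l1 w) * ?e"
  proof (induction w rule: lattice_induct)
    case (step x \<alpha>)
    have "\<bar>(\<Sum>u\<in>?B. g (u + \<alpha> + x)) - (\<Sum>u\<in>?B. g (u + x))\<bar> \<le> ?e"
      by (rule unit[of \<alpha> "\<lambda>u. g (u + x)"]) (use step g in auto)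
    moreover have "u + \<alpha> + x = u + (x + \<alpha>)" for u by (simp add: algebra_simps)
    ultimately have "\<bar>(\<Sum>u\<in>?B. g (u + (x + \<alpha>))) - (\<Sum>u\<in>?B. g (u + x))\<bar> \<le> ?e" by simp
    moreover have "real (l1 (x + \<alpha>)) * ?e = ?e + real (l1 x) * ?e"
      using step by (simp only: of_nat_Suc distrib_right mult_1 add.commute)
    ultimately show ?case using step by linarith
  qed simp
  then show "\<bar>(\<Sum>u\<in>?B. g (u + w)) - (\<Sum>u\<in>?B. g u)\<bar>
      \<le> 2 * C * real (l1 w) * real (card ?B) / real R"
    by (simp add: mult_ac)
qed

section \<open>The maximal ergodic inequality and midpoint convex sets\<close>

text \<open>\<open>s\<close> only has to lie below the ergodic sums of \<open>f\<close>. Thus one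
  statement covers the subadditive process \<open>T (n z) 0 - n r\<close> as well as the additive
  process \<open>n r - F (n z)\<close>.\<close>

lemma (in prob_space) maximal_ergodic:
  fixes f :: "'a \<Rightarrow> real" and s :: "nat \<Rightarrow> 'a \<Rightarrow> real"
  assumes U: "U \<in> measurable M M" and pres: "distr M M U = M"
    and f: "integrable M f"
    and s0: "\<And>\<omega>. \<omega> \<in> space M \<Longrightarrow> s 0 \<omega> \<le> 0"
    and sSuc: "\<And>n \<omega>. \<omega> \<in> space M \<Longrightarrow> s (Suc n) \<omega> \<le> f \<omega> + s n (U \<omega>)"
    and pos: "AE \<omega> in M. \<exists>n. s n \<omega> > 0"
  shows "expectation f \<ge> 0"
proof -
  note [measurable] = U borel_measurable_integrable[OF f]
  \<comment> \<open>Garsia's argument: \<open>m n\<close> is the maximum of \<open>0\<close> and the first \<open>n\<close> ergodic sums of \<open>f\<close>.\<close>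
  define m where "m = rec_nat (\<lambda>_. 0 :: real) (\<lambda>_ h \<omega>. max 0 (f \<omega> + h (U \<omega>)))"
  have m0: "m 0 \<omega> = 0" and mSuc: "m (Suc n) \<omega> = max 0 (f \<omega> + m n (U \<omega>))" for n \<omega>
    by (simp_all add: m_def)
  have sp: "U \<omega> \<in> space M" if "\<omega> \<in> space M" for \<omega>
    using measurable_space[OF U that] .
  have m_meas [measurable]: "m n \<in> borel_measurable M" for n
  proof (induction n)
    case 0
    have "m 0 = (\<lambda>_. 0)" by (rule ext) (rule m0)
    then show ?case by simp
  next
    case (Suc n)
    note [measurable] = Suc
    have "m (Suc n) = (\<lambda>\<omega>. max 0 (f \<omega> + m n (U \<omega>)))" by (rule ext) (rule mSuc)
    then show ?case by simp
  qed
  have int_U: "integrable M (\<lambda>\<omega>. h (U \<omega>)) \<and> expectation (\<lambda>\<omega>. h (U \<omega>)) = expectation h"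
    if "integrable M h" for h :: "'a \<Rightarrow> real"
    using integrable_distr[OF U, of h] integral_distr[OF U, of h] that pres
    by (simp add: borel_measurable_integrable)
  have m_int: "integrable M (m n)" for n
  proof (induction n)
    case 0
    have "m 0 = (\<lambda>_. 0)" by (rule ext) (rule m0)
    then show ?case by simp
  next
    case (Suc n)
    have "m (Suc n) = (\<lambda>\<omega>. max 0 (f \<omega> + m n (U \<omega>)))" by (rule ext) (rule mSuc)
    then show ?case using int_U[OF Suc] f by simp
  qed
  have m_nonneg: "m n \<omega> \<ge> 0" for n \<omega>
    by (cases n) (simp_all add: m0 mSuc)
  have m_mono: "m n \<omega> \<le> m (Suc n) \<omega>" for n \<omega>
  proof (induction n arbitrary: \<omega>)
    case 0
    show ?case using m0 m_nonneg by simp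
  next
    case (Suc n)
    show ?case using Suc[of "U \<omega>"] mSuc[of n \<omega>] mSuc[of "Suc n" \<omega>] by linarith
  qed
  have s_le_m: "\<omega> \<in> space M \<Longrightarrow> s n \<omega> \<le> m n \<omega>" for n \<omega>
  proof (induction n arbitrary: \<omega>)
    case 0
    then show ?case using s0 m0 by simp
  next
    case (Suc n)
    then show ?case using sSuc[of \<omega> n] Suc.IH[OF sp[OF Suc.prems]] mSuc[of n \<omega>] by linarith
  qed
  \<comment> \<open>Where \<open>m (Suc n)\<close> is positive it equals \<open>f\<close> plus
    \<open>m n\<close> after \<open>U\<close>, hence is at most \<open>f\<close> plus
    \<open>m (Suc n)\<close> after \<open>U\<close>; elsewhere it vanishes. So \<open>J n\<close>
    dominates \<open>m (Suc n)\<close> minus its composition with \<open>U\<close>, a function of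
    mean 0, and by \<open>pos\<close> it is almost surely equal to \<open>f\<close> for large
    \<open>n\<close>.\<close>
  define J where "J n \<omega> = (if m (Suc n) \<omega> > 0 then f \<omega> else 0)" for n \<omega>
  have [measurable]: "J n \<in> borel_measurable M" for n
    unfolding J_def by measurable
  have J_bd: "\<bar>J n \<omega>\<bar> \<le> \<bar>f \<omega>\<bar>" for n \<omega>
    by (simp add: J_def)
  have J_int: "integrable M (J n)" for n
    by (rule Bochner_Integration.integrable_bound[OF f]) (use J_bd in auto)
  have J_ge: "m (Suc n) \<omega> - m (Suc n) (U \<omega>) \<le> J n \<omega>" for n \<omega>
    using mSuc[of n \<omega>] m_mono[of n "U \<omega>"] m_nonneg[of "Suc n" "U \<omega>"] m_nonneg[of "Suc n" \<omega>]
    by (auto simp: J_def)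
  have J_nonneg: "expectation (J n) \<ge> 0" for n
  proof -
    have "0 = expectation (\<lambda>\<omega>. m (Suc n) \<omega> - m (Suc n) (U \<omega>))"
      using int_U[OF m_int[of "Suc n"]] m_int[of "Suc n"] by simp
    also have "\<dots> \<le> expectation (J n)"
      using int_U[OF m_int[of "Suc n"]] m_int[of "Suc n"] J_int J_ge
      by (intro integral_mono) auto
    finally show ?thesis .
  qed
  have "(\<lambda>n. expectation (J n)) \<longlonglongrightarrow> expectation f"
  proof (rule integral_dominated_convergence[where w = "\<lambda>\<omega>. \<bar>f \<omega>\<bar>"])
    show "AE \<omega> in M. (\<lambda>n. J n \<omega>) \<longlonglongrightarrow> f \<omega>"
      using pos AE_space
    proof eventually_elim
      case (elim \<omega>)
      then obtain n where n: "s n \<omega> > 0" by blast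
      have "\<forall>k\<ge>n. J k \<omega> = f \<omega>"
      proof (intro allI impI)
        fix k assume "n \<le> k"
        then have "m n \<omega> \<le> m (Suc k) \<omega>"
          using lift_Suc_mono_le[of "\<lambda>n. m n \<omega>" n "Suc k"] m_mono by simp
        then show "J k \<omega> = f \<omega>"
          using n s_le_m[of \<omega> n] elim by (simp add: J_def)
      qed
      then show ?case
        by (intro tendsto_eventually) (auto simp: eventually_sequentially)
    qed
  qed (use f J_bd in auto)
  then show ?thesis
    by (rule LIMSEQ_le_const) (use J_nonneg in auto)
qed

text \<open>Almost minimizers of the \<open>L\<^sup>2\<close> norm over a decreasing sequence of midpoint convex sets form
  a Cauchy sequence, by the parallelogram law.\<close>

lemma (in prob_space) midpoint_convex_AE_convergent:
  fixes P :: "nat \<Rightarrow> ('a \<Rightarrow> real) \<Rightarrow> bool"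
  assumes meas: "\<And>n g. P n g \<Longrightarrow> g \<in> borel_measurable M"
    and bd: "\<And>n g \<omega>. P n g \<Longrightarrow> \<omega> \<in> space M \<Longrightarrow> \<bar>g \<omega>\<bar> \<le> C"
    and ne: "\<And>n. \<exists>g. P n g"
    and anti: "\<And>n g. P (Suc n) g \<Longrightarrow> P n g"
    and mid: "\<And>n g h. P n g \<Longrightarrow> P n h \<Longrightarrow> P n (\<lambda>\<omega>. (g \<omega> + h \<omega>) / 2)"
  obtains g where "\<And>n. P n (g n)" "AE \<omega> in M. convergent (\<lambda>n. g n \<omega>)"
proof -
  define E where "E g = expectation (\<lambda>\<omega>. (g \<omega>)\<^sup>2)" for g :: "'a \<Rightarrow> real"
  have sq_int: "integrable M (\<lambda>\<omega>. (g \<omega>)\<^sup>2)" if "P n g" for n g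
  proof (rule integrable_const_bound[where B = "C\<^sup>2"])
    show "AE \<omega> in M. norm ((g \<omega>)\<^sup>2) \<le> C\<^sup>2"
    proof (rule AE_I2)
      fix \<omega> assume "\<omega> \<in> space M"
      then show "norm ((g \<omega>)\<^sup>2) \<le> C\<^sup>2"
        using power_mono[OF bd[OF that], of \<omega> 2] by simp
    qed
    show "(\<lambda>\<omega>. (g \<omega>)\<^sup>2) \<in> borel_measurable M" using meas[OF that] by simp
  qed
  have g_int: "integrable M g" if "P n g" for n g
    by (rule integrable_const_bound[where B = C]) (use bd[OF that] meas[OF that] in auto)
  have E_nonneg: "E g \<ge> 0" for g
    unfolding E_def by simp
  have E_le: "E g \<le> C\<^sup>2" if "P n g" for n g
  proof -
    have "E g \<le> expectation (\<lambda>_. C\<^sup>2)"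
      unfolding E_def
    proof (rule integral_mono[OF sq_int[OF that]])
      fix \<omega> assume "\<omega> \<in> space M"
      then show "(g \<omega>)\<^sup>2 \<le> C\<^sup>2" using power_mono[OF bd[OF that], of \<omega> 2] by simp
    qed simp
    then show ?thesis by (simp add: prob_space)
  qed
  define I where "I n = (INF g\<in>{g. P n g}. E g)" for n
  have I_le: "I n \<le> E g" if "P n g" for n g
    unfolding I_def using that E_nonneg by (intro cINF_lower bdd_belowI2[where m = 0]) auto
  have anti': "P n g" if "P m g" "n \<le> m" for n m g
    using that(2,1) by (induction rule: dec_induct) (auto dest: anti)
  have I_mono: "I n \<le> I m" if "n \<le> m" for n m
    unfolding I_def
  proof (rule cINF_superset_mono)
    show "{g. P m g} \<noteq> {}" using ne by auto
    show "bdd_below (E ` {g. P n g})" using E_nonneg by (intro bdd_belowI2[where m = 0]) auto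
  qed (use anti'[OF _ that] in auto)
  have I_bd: "I n \<le> C\<^sup>2" for n
    using ne[of n] I_le E_le by (meson order_trans)
  have "\<exists>g. P n g \<and> E g < I n + 1 / real (Suc n)" for n
  proof -
    have "I n < I n + 1 / real (Suc n)" by simp
    then show ?thesis
      unfolding I_def using ne[of n] E_nonneg
      by (subst (asm) cINF_less_iff) (auto intro: bdd_belowI2[where m = 0])
  qed
  then obtain g where g: "\<And>n. P n (g n)" "\<And>n. E (g n) < I n + 1 / real (Suc n)"
    by metis
  obtain J where J: "I \<longlonglongrightarrow> J"
    by (rule incseq_convergent[of I "C\<^sup>2"]) (use I_mono I_bd in \<open>auto simp: incseq_def\<close>)
  have I_J: "I n \<le> J" for n
    using J I_mono by (intro incseq_le) (auto simp: incseq_def)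
  obtain r where r: "strict_mono r" "AE \<omega> in M. Cauchy (\<lambda>i. g (r i) \<omega>)"
  proof (rule cauchy_L1_AE_cauchy_subseq[of M g])
    fix e :: real assume "e > 0"
    \<comment> \<open>The eighth is what the parallelogram law allows: with both energies below J +
      e^2/8 and that of the midpoint above J - e^2/8, the squared L2 distance is below 4(J + e^2/8)
      - 4(J - e^2/8) = e^2.\<close>
    then have e: "e\<^sup>2 / 8 > 0" by simp
    have "(\<lambda>n. 1 / real (Suc n)) \<longlonglongrightarrow> 0" using LIMSEQ_inverse_real_of_nat by (simp add: field_simps)
    then have "\<forall>\<^sub>F n in sequentially. 1 / real (Suc n) < e\<^sup>2 / 8"
      using e by (rule order_tendstoD)
    moreover have "\<forall>\<^sub>F n in sequentially. I n > J - e\<^sup>2 / 8"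
      using J e by (intro order_tendstoD) auto
    ultimately have "\<forall>\<^sub>F n in sequentially. 1 / real (Suc n) < e\<^sup>2 / 8 \<and> I n > J - e\<^sup>2 / 8"
      by (rule eventually_conj)
    then obtain N where N: "1 / real (Suc N) < e\<^sup>2 / 8" "I N > J - e\<^sup>2 / 8"
      by (auto simp: eventually_sequentially)
    show "\<exists>N. \<forall>i\<ge>N. \<forall>j\<ge>N. LINT \<omega>|M. norm (g i \<omega> - g j \<omega>) < e"
    proof (intro exI allI impI)
      fix i j assume ij: "N \<le> i" "N \<le> j"
      have P: "P N (g i)" "P N (g j)" using anti' g(1) ij by blast+
      have small: "E (g k) < J + e\<^sup>2 / 8" if "N \<le> k" for k
      proof -
        have "1 / real (Suc k) \<le> 1 / real (Suc N)" using that by (intro divide_left_mono) auto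
        then show ?thesis using g(2)[of k] I_J[of k] N(1) by linarith
      qed
      let ?m = "\<lambda>\<omega>. (g i \<omega> + g j \<omega>) / 2" and ?d = "\<lambda>\<omega>. \<bar>g i \<omega> - g j \<omega>\<bar>"
      have Pm: "P N ?m" using mid[OF P] .
      have par: "(?d \<omega>)\<^sup>2 = 2 * (g i \<omega>)\<^sup>2 + 2 * (g j \<omega>)\<^sup>2 - 4 * (?m \<omega>)\<^sup>2" for \<omega>
        by (simp add: power2_eq_square field_simps)
      have d2: "integrable M (\<lambda>\<omega>. (?d \<omega>)\<^sup>2)"
        unfolding par using sq_int[OF P(1)] sq_int[OF P(2)] sq_int[OF Pm] by simp
      have "expectation (\<lambda>\<omega>. (?d \<omega>)\<^sup>2) = 2 * E (g i) + 2 * E (g j) - 4 * E ?m"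
        unfolding par E_def using sq_int[OF P(1)] sq_int[OF P(2)] sq_int[OF Pm] by simp
      also have "\<dots> < e\<^sup>2"
        using small[OF ij(1)] small[OF ij(2)] I_le[OF Pm] N(2) by linarith
      finally have lt: "expectation (\<lambda>\<omega>. (?d \<omega>)\<^sup>2) < e\<^sup>2" .
      have d1: "integrable M ?d" using g_int[OF P(1)] g_int[OF P(2)] by simp
      \<comment> \<open>Nonnegativity of the variance turns the L2 estimate into the L1 estimate
        from which an almost surely Cauchy subsequence is extracted.\<close>
      have "variance ?d = expectation (\<lambda>\<omega>. (?d \<omega>)\<^sup>2) - (expectation ?d)\<^sup>2"
        by (rule variance_eq[OF d1 d2])
      then have "(expectation ?d)\<^sup>2 < e\<^sup>2" using lt variance_positive[of ?d] by linarith
      then have "expectation ?d < e" using \<open>e > 0\<close> by (simp add: power_less_imp_less_base)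
      then show "LINT \<omega>|M. norm (g i \<omega> - g j \<omega>) < e" by simp
    qed
  qed (use g_int g(1) in auto)
  show ?thesis
  proof
    show "P n (g (r n))" for n using anti'[OF g(1)] seq_suble[OF r(1)] by blast
    show "AE \<omega> in M. convergent (\<lambda>n. g (r n) \<omega>)"
      using r(2) by (simp add: Cauchy_convergent_iff)
  qed
qed

section \<open>Measure preservation, ergodicity and almost sure constants\<close>

context ergodic_action
begin

lemma V_in_space [simp]: "\<omega> \<in> space M \<Longrightarrow> V x \<omega> \<in> space M"
  using measurable_space[OF measurable_V] .

lemma V_0 [simp]: "\<omega> \<in> space M \<Longrightarrow> V 0 \<omega> = \<omega>"
  using group_law[of \<omega> 0 0] bij_betw_imp_inj_on[OF invertible[of 0]] by (auto dest: inj_onD)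

lemma V_uminus_V [simp]: "\<omega> \<in> space M \<Longrightarrow> V (- x) (V x \<omega>) = \<omega>"
  using group_law[of \<omega> "- x" x] by simp

lemma integrable_V:
  fixes f :: "'w \<Rightarrow> real"
  shows "integrable M f \<Longrightarrow> integrable M (\<lambda>\<omega>. f (V x \<omega>))"
  using integrable_distr[OF measurable_V, of x f] by (simp add: measure_preserving)

lemma expectation_V:
  fixes f :: "'w \<Rightarrow> real"
  shows "f \<in> borel_measurable M \<Longrightarrow> expectation (\<lambda>\<omega>. f (V x \<omega>)) = expectation f"
  using integral_distr[OF measurable_V, of f x] by (simp add: measure_preserving)

lemma AE_V: "AE \<omega> in M. P \<omega> \<Longrightarrow> AE \<omega> in M. P (V x \<omega>)"
  by (rule AE_distrD[OF measurable_V]) (subst measure_preserving)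

text \<open>Inclusion in one direction suffices: it also applies to \<open>- x\<close>, and
  \<open>V (- x)\<close> inverts \<open>V x\<close>.\<close>

lemma invariant_set_prob_0_1:
  assumes B: "B \<in> sets M" and inv: "\<And>x \<omega>. \<omega> \<in> B \<Longrightarrow> V x \<omega> \<in> B"
  shows "prob B = 0 \<or> prob B = 1"
proof (rule ergodic[OF B], intro allI impI equalityI subsetI)
  fix y \<omega> assume "\<omega> \<in> B"
  then have "\<omega> \<in> space M" using sets.sets_into_space[OF B] by blast
  then have "\<omega> = V y (V (- y) \<omega>)" using V_uminus_V[of \<omega> "- y"] by simp
  then show "\<omega> \<in> V y ` B" using inv[OF \<open>\<omega> \<in> B\<close>] by (metis imageI)
qed (use inv in auto)

text \<open>The constant is \<open>esssup M X\<close>: a sublevel set at a rational below it is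
  invariant and not of full probability, hence null. Values in \<open>ereal\<close> admit upper and
  lower limits before these are known to be finite.\<close>

lemma invariant_imp_AE_const:
  fixes X :: "'w \<Rightarrow> ereal"
  assumes [measurable]: "X \<in> borel_measurable M"
    and inv: "\<And>x \<omega>. \<omega> \<in> space M \<Longrightarrow> X (V x \<omega>) = X \<omega>"
  obtains c where "AE \<omega> in M. X \<omega> = c"
proof
  let ?c = "esssup M X"
  have "AE \<omega> in M. \<not> X \<omega> \<le> q" if "q < ?c" for q :: ereal
  proof -
    let ?B = "{\<omega>\<in>space M. X \<omega> \<le> q}"
    have B: "?B \<in> sets M" by measurable
    have "prob ?B \<noteq> 1"
    proof
      assume "prob ?B = 1"
      then have "AE \<omega> in M. X \<omega> \<le> q"
        using prob_eq_1[OF B] by (auto elim: eventually_mono)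
      then have "?c \<le> q" by (intro esssup_I) auto
      then show False using that by simp
    qed
    then have "prob ?B = 0"
      using invariant_set_prob_0_1[OF B] inv by auto
    then show ?thesis
      using prob_eq_0[OF B] AE_space by (auto elim: eventually_mono)
  qed
  then have "AE \<omega> in M. \<forall>q\<in>{q::rat. ereal (of_rat q) < ?c}. \<not> X \<omega> \<le> ereal (of_rat q)"
    by (subst AE_ball_countable) auto
  then show "AE \<omega> in M. X \<omega> = ?c"
    using esssup_AE[where M = M and f = X]
  proof eventually_elim
    case (elim \<omega>)
    show ?case
    proof (rule antisym[OF elim(2)], rule ccontr)
      assume "\<not> ?c \<le> X \<omega>"
      then obtain q where q: "X \<omega> < ereal (of_rat q)" "ereal (of_rat q) < ?c"
        using ereal_dense3 by (meson not_le)
      then show False using elim(1) by (auto simp: less_imp_le)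
    qed
  qed
qed

end

lemma eventually_le_linear:
  fixes C \<eta> :: real
  assumes "0 < \<eta>"
  shows "\<forall>\<^sub>F n in sequentially. C \<le> \<eta> * real n"
proof -
  obtain N :: nat where N: "C / \<eta> \<le> real N" using real_arch_simple by blast
  show ?thesis
  proof (rule eventually_sequentiallyI[of N])
    fix n assume "N \<le> n"
    then have "C / \<eta> \<le> real n" using N by simp
    then show "C \<le> \<eta> * real n" using assms by (simp add: field_simps)
  qed
qed

lemma eventually_div:
  assumes "\<forall>\<^sub>F q in sequentially. P q" and "0 < k"
  shows "\<forall>\<^sub>F n in sequentially. P (n div k :: nat)"
proof -
  obtain N where N: "\<And>q. N \<le> q \<Longrightarrow> P q"
    using assms(1) by (auto simp: eventually_sequentially)
  show ?thesis
  proof (rule eventually_sequentiallyI[of "N * k"])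
    fix n assume "N * k \<le> n"
    then have "N \<le> n div k" using \<open>0 < k\<close> by (simp add: less_eq_div_iff_mult_less_eq)
    then show "P (n div k)" by (rule N)
  qed
qed

section \<open>Passage times\<close>

lemma paths_singleton [simp]: "[x] \<in> paths x x"
  by (simp add: paths_def)

lemma paths_Cons:
  assumes \<alpha>: "\<alpha> \<in> steps" and \<gamma>: "\<gamma> \<in> paths (x + \<alpha>) y"
  shows "x # \<gamma> \<in> paths x y"
    and "path_weight \<tau> \<omega> (x # \<gamma>) = \<tau> x \<alpha> \<omega> + path_weight \<tau> \<omega> \<gamma>"
proof -
  obtain \<gamma>' where \<gamma>': "\<gamma> = (x + \<alpha>) # \<gamma>'"
    using \<gamma> by (cases \<gamma>) (auto simp: paths_def)
  show "x # \<gamma> \<in> paths x y"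
    using \<alpha> \<gamma> unfolding \<gamma>' by (auto simp: paths_def nth_Cons split: nat.splits)
  show "path_weight \<tau> \<omega> (x # \<gamma>) = \<tau> x \<alpha> \<omega> + path_weight \<tau> \<omega> \<gamma>"
    unfolding \<gamma>' by (simp add: path_weight_def sum.lessThan_Suc_shift del: sum.lessThan_Suc)
qed

lemma paths_nonempty: "paths x (y :: int ^ 'd) \<noteq> {}"
proof -
  have "paths (y + w) y \<noteq> {}" for w :: "int ^ 'd"
  proof (induction w rule: lattice_induct)
    case zero
    then show ?case by (auto intro: paths_singleton)
  next
    case (step w \<alpha>)
    then obtain \<gamma> where "\<gamma> \<in> paths (y + w) y" by auto
    then have "(y + (w + \<alpha>)) # \<gamma> \<in> paths (y + (w + \<alpha>)) y"
      using step(1) by (intro paths_Cons(1)[of "- \<alpha>"]) (auto simp: uminus_steps add.assoc)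
    then show ?case by auto
  qed
  from this[of "x - y"] show ?thesis by simp
qed

text \<open>Telescoping along the path. Functions that drop by at most the edge weight along each
  edge, called potentials below, are the main source of lower bounds for passage times.\<close>

lemma path_potential:
  fixes \<psi> :: "int ^ 'd \<Rightarrow> real"
  assumes \<gamma>: "\<gamma> \<in> paths x y"
    and \<psi>: "\<And>x \<alpha>. \<alpha> \<in> steps \<Longrightarrow> \<psi> x - \<psi> (x + \<alpha>) \<le> \<tau> x \<alpha> \<omega>"
  shows "\<psi> x - \<psi> y \<le> path_weight \<tau> \<omega> \<gamma>"
proof -
  have *: "\<psi> (\<gamma> ! 0) - \<psi> (\<gamma> ! k) \<le> (\<Sum>i<k. \<tau> (\<gamma> ! i) (\<gamma> ! Suc i - \<gamma> ! i) \<omega>)" if "k < length \<gamma>" for k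
    using that
  proof (induction k)
    case (Suc k)
    have "\<gamma> ! Suc k - \<gamma> ! k \<in> steps" using \<gamma> Suc by (simp add: paths_def)
    from \<psi>[OF this, of "\<gamma> ! k"] show ?case using Suc by simp
  qed simp
  have "\<gamma> \<noteq> []" "\<gamma> ! 0 = x" "\<gamma> ! (length \<gamma> - 1) = y"
    using \<gamma> by (auto simp: paths_def hd_conv_nth last_conv_nth)
  with *[of "length \<gamma> - 1"] show ?thesis by (simp add: path_weight_def)
qed

lemma passage_time_ge_potential:
  assumes "\<And>x \<alpha>. \<alpha> \<in> steps \<Longrightarrow> \<psi> x - \<psi> (x + \<alpha>) \<le> \<tau> x \<alpha> \<omega>"
  shows "\<psi> x - \<psi> y \<le> passage_time \<tau> x y \<omega>"
  unfolding passage_time_def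
  by (rule cINF_greatest[OF paths_nonempty]) (rule path_potential, use assms in auto)

text \<open>The bounds hold at every point of the sample space instead of almost everywhere, so
  real-valued infima over paths behave well everywhere and identities for passage times carry no
  null sets. The final theorem reaches this situation by changing the weights on a null set.\<close>

locale bounded_percolation = ergodic_action M V
  for M :: "'w measure" and V :: "int ^ 'd \<Rightarrow> 'w \<Rightarrow> 'w" +
  fixes \<tau> :: "int ^ 'd \<Rightarrow> int ^ 'd \<Rightarrow> 'w \<Rightarrow> real" and a b :: real
  assumes a_pos: "0 < a"
    and measurable_weight: "\<alpha> \<in> steps \<Longrightarrow> \<tau> x \<alpha> \<in> borel_measurable M"
    and weight_bounds: "\<lbrakk>\<alpha> \<in> steps; \<omega> \<in> space M\<rbrakk> \<Longrightarrow> a \<le> \<tau> x \<alpha> \<omega> \<and> \<tau> x \<alpha> \<omega> \<le> b"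
    and stationary: "\<lbrakk>\<alpha> \<in> steps; \<omega> \<in> space M\<rbrakk> \<Longrightarrow> \<tau> (x + y) \<alpha> \<omega> = \<tau> x \<alpha> (V y \<omega>)"
begin

abbreviation T :: "int ^ 'd \<Rightarrow> int ^ 'd \<Rightarrow> 'w \<Rightarrow> real"
  where "T \<equiv> passage_time \<tau>"

definition t :: "int ^ 'd \<Rightarrow> real"
  where "t x = expectation (T x 0)"

lemma b_pos: "0 < b"
proof -
  obtain \<omega> where "\<omega> \<in> space M" using not_empty by auto
  then show ?thesis using a_pos weight_bounds[of "axis undefined 1" \<omega> 0] by force
qed

lemma weight_nonneg: "\<alpha> \<in> steps \<Longrightarrow> \<omega> \<in> space M \<Longrightarrow> 0 \<le> \<tau> x \<alpha> \<omega>"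
  using weight_bounds[of \<alpha> \<omega> x] a_pos by linarith

lemma T_nonneg: "\<omega> \<in> space M \<Longrightarrow> 0 \<le> T x y \<omega>"
  using passage_time_ge_potential[of "\<lambda>_. 0" \<tau> \<omega> x y] weight_nonneg by simp

lemma path_weight_nonneg: "\<omega> \<in> space M \<Longrightarrow> \<gamma> \<in> paths x y \<Longrightarrow> 0 \<le> path_weight \<tau> \<omega> \<gamma>"
  using path_potential[of \<gamma> x y "\<lambda>_. 0" \<tau> \<omega>] weight_nonneg by simp

lemma T_le_path_weight: "\<omega> \<in> space M \<Longrightarrow> \<gamma> \<in> paths x y \<Longrightarrow> T x y \<omega> \<le> path_weight \<tau> \<omega> \<gamma>"
  unfolding passage_time_def
  by (rule cINF_lower) (auto intro!: bdd_belowI2[where m = 0] path_weight_nonneg)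

lemma T_self [simp]: "\<omega> \<in> space M \<Longrightarrow> T x x \<omega> = 0"
  using T_le_path_weight[of \<omega> "[x]" x x] T_nonneg[of \<omega> x x] by (simp add: path_weight_def)

lemma T_step:
  assumes \<omega>: "\<omega> \<in> space M" and \<alpha>: "\<alpha> \<in> steps"
  shows "T x y \<omega> - T (x + \<alpha>) y \<omega> \<le> \<tau> x \<alpha> \<omega>"
proof -
  have "T x y \<omega> - \<tau> x \<alpha> \<omega> \<le> T (x + \<alpha>) y \<omega>"
    unfolding passage_time_def[of \<tau> "x + \<alpha>"]
  proof (rule cINF_greatest[OF paths_nonempty])
    fix \<gamma> assume "\<gamma> \<in> paths (x + \<alpha>) y"
    then show "T x y \<omega> - \<tau> x \<alpha> \<omega> \<le> path_weight \<tau> \<omega> \<gamma>"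
      using paths_Cons(1)[OF \<alpha>, of \<gamma> x y] paths_Cons(2)[OF \<alpha>, of \<gamma> x y \<tau> \<omega>] T_le_path_weight[OF \<omega>, of "x # \<gamma>" x y] by linarith
  qed
  then show ?thesis by linarith
qed

text \<open>By \<open>T_step\<close>, \<open>T x z\<close> is itself a potential as a function of
  \<open>x\<close>; this takes the place of concatenating paths.\<close>

lemma T_triangle: "\<omega> \<in> space M \<Longrightarrow> T x z \<omega> \<le> T x y \<omega> + T y z \<omega>"
  using passage_time_ge_potential[of "\<lambda>x. T x z \<omega>" \<tau> \<omega> x y] T_step by fastforce

lemma T_le_l1:
  assumes \<omega>: "\<omega> \<in> space M"
  shows "T x y \<omega> \<le> b * l1 (x - y)"
proof -
  have "T (y + w) y \<omega> \<le> b * l1 w" for w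
  proof (induction w rule: lattice_induct)
    case (step w \<alpha>)
    have "T (y + (w + \<alpha>)) y \<omega> - T (y + w) y \<omega> \<le> \<tau> (y + (w + \<alpha>)) (- \<alpha>) \<omega>"
      using T_step[OF \<omega> uminus_steps[OF step(1)], of "y + (w + \<alpha>)" y] by (simp add: add.assoc)
    also have "\<dots> \<le> b" using weight_bounds[OF uminus_steps[OF step(1)] \<omega>] by blast
    finally show ?case using step by (simp add: distrib_left)
  qed (use \<omega> in simp)
  from this[of "x - y"] show ?thesis by simp
qed

lemma T_lipschitz: "\<omega> \<in> space M \<Longrightarrow> \<bar>T x z \<omega> - T y z \<omega>\<bar> \<le> b * l1 (x - y)"
  using T_triangle[of \<omega> x z y] T_triangle[of \<omega> y z x] T_le_l1[of \<omega> x y] T_le_l1[of \<omega> y x]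
    l1_minus[of "x - y"] by simp

text \<open>Translated passage times are potentials for the translated weights, which gives one
  inequality. The other is the same inequality for \<open>- w\<close> in the environment
  \<open>V w \<omega>\<close>.\<close>

lemma T_shift:
  assumes \<omega>: "\<omega> \<in> space M"
  shows "T (x + w) (y + w) \<omega> = T x y (V w \<omega>)"
proof -
  have le: "T (x + w) (y + w) \<omega> \<le> T x y (V w \<omega>)" if "\<omega> \<in> space M" for x y w \<omega>
  proof -
    have "T (x + w) (y + w) \<omega> - T (y + w) (y + w) \<omega> \<le> T x y (V w \<omega>)"
    proof (rule passage_time_ge_potential[of "\<lambda>x. T (x + w) (y + w) \<omega>"])
      fix x \<alpha> assume "\<alpha> \<in> (steps :: (int ^ 'd) set)"
      then show "T (x + w) (y + w) \<omega> - T (x + \<alpha> + w) (y + w) \<omega> \<le> \<tau> x \<alpha> (V w \<omega>)"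
        using T_step[OF that, of \<alpha> "x + w" "y + w"] stationary[of \<alpha> \<omega> x w] that
        by (simp add: algebra_simps)
    qed
    then show ?thesis using that by simp
  qed
  show ?thesis
    using le[OF \<omega>, of x w y] le[of "V w \<omega>" "x + w" "- w" "y + w"] \<omega> by simp
qed

lemma measurable_T [measurable]: "T x y \<in> borel_measurable M"
proof -
  have "(\<lambda>\<omega>. INF \<gamma>\<in>paths x y. path_weight \<tau> \<omega> \<gamma>) \<in> borel_measurable M"
  proof (rule borel_measurable_cINF)
    fix \<gamma> assume "\<gamma> \<in> paths x y"
    then show "(\<lambda>\<omega>. path_weight \<tau> \<omega> \<gamma>) \<in> borel_measurable M"
      unfolding path_weight_def
      by (intro borel_measurable_sum measurable_weight) (auto simp: paths_def)
  next
    fix \<omega> assume "\<omega> \<in> space M"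
    then show "bdd_below ((\<lambda>\<gamma>. path_weight \<tau> \<omega> \<gamma>) ` paths x y)"
      by (intro bdd_belowI2[where m = 0] path_weight_nonneg)
  qed auto
  moreover have "T x y = (\<lambda>\<omega>. INF \<gamma>\<in>paths x y. path_weight \<tau> \<omega> \<gamma>)"
    by (simp add: passage_time_def fun_eq_iff)
  ultimately show ?thesis by simp
qed

lemma integrable_T: "integrable M (T x y)"
  by (rule integrable_const_bound[where B = "b * l1 (x - y)"]) (use T_nonneg T_le_l1 in auto)

lemma expectation_T: "expectation (T x y) = t (x - y)"
proof -
  have "expectation (T x y) = expectation (\<lambda>\<omega>. T (x - y) 0 (V y \<omega>))"
    using T_shift[of _ "x - y" y 0] by (intro Bochner_Integration.integral_cong) auto
  then show ?thesis by (simp add: expectation_V t_def)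
qed

lemma t_nonneg: "0 \<le> t x"
  unfolding t_def by (rule integral_nonneg_AE) (auto intro: AE_I2 T_nonneg)

lemma t_le_l1: "t x \<le> b * l1 x"
proof -
  have "expectation (T x 0) \<le> expectation (\<lambda>_. b * l1 x)"
    using T_le_l1[of _ x 0] by (intro integral_mono integrable_T) auto
  then show ?thesis by (simp add: t_def prob_space)
qed

lemma t_subadd: "t (x + y) \<le> t x + t y"
proof -
  have "expectation (T (x + y) 0) \<le> expectation (\<lambda>\<omega>. T (x + y) y \<omega> + T y 0 \<omega>)"
    using T_triangle by (intro integral_mono Bochner_Integration.integrable_add integrable_T) auto
  then show ?thesis using expectation_T[of "x + y" y] by (simp add: t_def integrable_T)
qed

end

section \<open>Stationary Busemann cocycles\<close>

context bounded_percolation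
begin

text \<open>Since \<open>t\<close> is subadditive, this is the limit of \<open>t (k z) / k\<close>
  by Fekete's lemma; in the end it is the time constant at \<open>z\<close>. The form as an infimum
  lets a slope be compared with it one \<open>k\<close> at a time.\<close>

definition m :: "int ^ 'd \<Rightarrow> real"
  where "m z = (INF k\<in>{0<..}. t (int k *s z) / real k)"

lemma m_le: "0 < k \<Longrightarrow> m z \<le> t (int k *s z) / real k"
  unfolding m_def
  by (rule cINF_lower) (auto intro!: bdd_belowI2[where m = 0] divide_nonneg_nonneg t_nonneg)

text \<open>Every condition is stable under midpoints and gets stronger with \<open>n\<close>, as
  \<open>midpoint_convex_AE_convergent\<close> demands. The Lipschitz bound is exact, while the
  cocycle identity and the mean have slack of order \<open>1 / n\<close>; the slack in the cocycle
  identity has the shape of the error in \<open>box_average\<close>, with \<open>b l1 y\<close> as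
  the bound on the averaged function.\<close>

definition approx_busemann :: "int ^ 'd \<Rightarrow> nat \<Rightarrow> (int ^ 'd \<Rightarrow> 'w \<Rightarrow> real) \<Rightarrow> bool"
  where "approx_busemann z n g \<longleftrightarrow>
    (\<forall>y. g y \<in> borel_measurable M) \<and>
    (\<forall>\<omega>\<in>space M. g 0 \<omega> = 0) \<and>
    (\<forall>\<omega>\<in>space M. \<forall>x. \<forall>\<alpha>\<in>steps. g x \<omega> - g (x + \<alpha>) \<omega> \<le> \<tau> x \<alpha> \<omega>) \<and>
    (\<forall>\<omega>\<in>space M. \<forall>y w. \<bar>g (y + w) \<omega> - g y (V w \<omega>) - g w \<omega>\<bar>
      \<le> 2 * b * l1 y * l1 w / real (Suc n)) \<and>
    m z - 2 * b / real (Suc n) \<le> expectation (g z)"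

lemma lipschitz_bound:
  fixes g :: "int ^ 'd \<Rightarrow> real"
  assumes \<omega>: "\<omega> \<in> space M" and g0: "g 0 = 0"
    and g: "\<And>x \<alpha>. \<alpha> \<in> steps \<Longrightarrow> g x - g (x + \<alpha>) \<le> \<tau> x \<alpha> \<omega>"
  shows "\<bar>g y\<bar> \<le> b * l1 y"
proof -
  have "g x - g y \<le> T x y \<omega>" for x y
    by (rule passage_time_ge_potential) (rule g)
  from this[of 0 y] this[of y 0] show ?thesis
    using T_le_l1[OF \<omega>, of 0 y] T_le_l1[OF \<omega>, of y 0] g0 by simp
qed

lemma approx_busemann_bound:
  assumes "approx_busemann z n g" "\<omega> \<in> space M"
  shows "\<bar>g y \<omega>\<bar> \<le> b * l1 y"
  by (rule lipschitz_bound[OF assms(2), of "\<lambda>y. g y \<omega>"])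
    (use assms in \<open>auto simp: approx_busemann_def\<close>)

lemma approx_busemann_integrable:
  assumes "approx_busemann z n g"
  shows "integrable M (g y)"
  by (rule integrable_const_bound[where B = "b * l1 y"])
    (use assms approx_busemann_bound[OF assms] in \<open>auto simp: approx_busemann_def\<close>)

lemma approx_busemann_antimono:
  assumes "approx_busemann z (Suc n) g"
  shows "approx_busemann z n g"
proof -
  have le: "C / real (Suc (Suc n)) \<le> C / real (Suc n)" if "0 \<le> C" for C :: real
    using that by (intro divide_left_mono) auto
  have "2 * b * l1 y * l1 w / real (Suc (Suc n)) \<le> 2 * b * l1 y * l1 w / real (Suc n)" for y w :: "int ^ 'd"
    using b_pos by (intro le) auto
  moreover have "2 * b / real (Suc (Suc n)) \<le> 2 * b / real (Suc n)"
    using b_pos by (intro le) auto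
  ultimately show ?thesis
    using assms unfolding approx_busemann_def by (smt (verit))
qed

lemma approx_busemann_midpoint:
  assumes g: "approx_busemann z n g" and h: "approx_busemann z n h"
  shows "approx_busemann z n (\<lambda>y \<omega>. (g y \<omega> + h y \<omega>) / 2)"
  unfolding approx_busemann_def
proof (intro conjI ballI allI)
  fix \<omega> x \<alpha> assume *: "\<omega> \<in> space M" "\<alpha> \<in> (steps :: (int ^ 'd) set)"
  then have "g x \<omega> - g (x + \<alpha>) \<omega> \<le> \<tau> x \<alpha> \<omega>" "h x \<omega> - h (x + \<alpha>) \<omega> \<le> \<tau> x \<alpha> \<omega>"
    using g h by (auto simp: approx_busemann_def)
  then show "(g x \<omega> + h x \<omega>) / 2 - (g (x + \<alpha>) \<omega> + h (x + \<alpha>) \<omega>) / 2 \<le> \<tau> x \<alpha> \<omega>"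
    by (simp add: field_simps)
next
  fix \<omega> and y w :: "int ^ 'd" assume *: "\<omega> \<in> space M"
  let ?e = "2 * b * l1 y * l1 w / real (Suc n)"
  have "\<bar>g (y + w) \<omega> - g y (V w \<omega>) - g w \<omega>\<bar> \<le> ?e" "\<bar>h (y + w) \<omega> - h y (V w \<omega>) - h w \<omega>\<bar> \<le> ?e"
    using g h * unfolding approx_busemann_def by blast+
  moreover have "\<bar>(r + s) / 2\<bar> \<le> e" if "\<bar>r\<bar> \<le> e" "\<bar>s\<bar> \<le> e" for r s e :: real
    using that unfolding abs_le_iff by (simp add: field_simps)
  ultimately have "\<bar>((g (y + w) \<omega> - g y (V w \<omega>) - g w \<omega>)
      + (h (y + w) \<omega> - h y (V w \<omega>) - h w \<omega>)) / 2\<bar> \<le> ?e"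
    by blast
  then show "\<bar>(g (y + w) \<omega> + h (y + w) \<omega>) / 2 - (g y (V w \<omega>) + h y (V w \<omega>)) / 2
      - (g w \<omega> + h w \<omega>) / 2\<bar> \<le> ?e"
    by (simp add: diff_divide_distrib add_divide_distrib algebra_simps)
next
  have "expectation (\<lambda>\<omega>. (g z \<omega> + h z \<omega>) / 2) = (expectation (g z) + expectation (h z)) / 2"
    using approx_busemann_integrable[OF g] approx_busemann_integrable[OF h] by simp
  moreover have "m z - 2 * b / real (Suc n) \<le> expectation (g z)"
    "m z - 2 * b / real (Suc n) \<le> expectation (h z)"
    using g h by (auto simp: approx_busemann_def)
  moreover have "c \<le> (r + s) / 2" if "c \<le> r" "c \<le> s" for c r s :: real
    using that by simp
  ultimately show "m z - 2 * b / real (Suc n) \<le> expectation (\<lambda>\<omega>. (g z \<omega> + h z \<omega>) / 2)"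
    by metis
next
  fix y show "(\<lambda>\<omega>. (g y \<omega> + h y \<omega>) / 2) \<in> borel_measurable M"
    using g h by (intro borel_measurable_divide borel_measurable_add borel_measurable_const)
      (auto simp: approx_busemann_def)
qed (use g h in \<open>auto simp: approx_busemann_def\<close>)

text \<open>Busemann-type increments \<open>T y s - T 0 s\<close>, averaged over target points \<open>s = u - j z\<close>: the box
  average over \<open>u\<close> makes them nearly a cocycle, and the average over \<open>j\<close> telescopes in the mean.\<close>

lemma approx_busemann_exists: "\<exists>g. approx_busemann z n g"
proof -
  obtain B :: "(int ^ 'd) set" where B: "finite B" "B \<noteq> {}"
    and box: "\<And>(g :: int ^ 'd \<Rightarrow> real) C w. (\<And>x. \<bar>g x\<bar> \<le> C) \<Longrightarrow>
      \<bar>(\<Sum>u\<in>B. g (u + w)) - (\<Sum>u\<in>B. g u)\<bar>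
        \<le> 2 * C * real (l1 w) * real (card B) / real (Suc n)"
    using box_average[of "Suc n"] by blast
  define L where "L = Max (l1 ` B)"
  have L: "l1 u \<le> L" if "u \<in> B" for u
    unfolding L_def using B that by (intro Max_ge) auto
  \<comment> \<open>Summing over \<open>j\<close> leaves \<open>t (N z - u) - t (- u)\<close>, which
    falls short of \<open>N m z\<close> by at most \<open>t u + t (- u) \<le> 2 b L\<close>. With
    \<open>N \<ge> L (n + 1)\<close> this loss, divided by \<open>N\<close>, is at most
    \<open>2 b / (n + 1)\<close>.\<close>
  define N where "N = Suc (L * Suc n)"
  define A where "A h = (\<Sum>j<N. \<Sum>u\<in>B. h (u - int j *s z)) / (real N * real (card B))"
    for h :: "int ^ 'd \<Rightarrow> real"
  have cB: "real (card B) > 0" using B by (simp add: card_gt_0_iff)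
  have N: "real N > 0" unfolding N_def of_nat_0_less_iff by simp
  have A_diff: "A h - A k = A (\<lambda>s. h s - k s)" for h k
    by (simp add: A_def sum_subtractf diff_divide_distrib)
  have A_le: "A h \<le> c" if "\<And>s. h s \<le> c" for h c
  proof -
    have "(\<Sum>j<N. \<Sum>u\<in>B. h (u - int j *s z)) \<le> (\<Sum>j<N. \<Sum>u\<in>B. c)"
      by (intro sum_mono that)
    then show ?thesis using cB N by (simp add: A_def field_simps)
  qed
  have A_shift: "\<bar>A (\<lambda>s. h (s - w)) - A h\<bar> \<le> 2 * C * l1 w / real (Suc n)"
    if h: "\<And>s. \<bar>h s\<bar> \<le> C" for h C w
  proof -
    have "\<bar>(\<Sum>j<N. (\<Sum>u\<in>B. h (u - int j *s z - w)) - (\<Sum>u\<in>B. h (u - int j *s z)))\<bar>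
        \<le> (\<Sum>j<N. \<bar>(\<Sum>u\<in>B. h (u - int j *s z - w)) - (\<Sum>u\<in>B. h (u - int j *s z))\<bar>)"
      by (rule sum_abs)
    also have "\<dots> \<le> (\<Sum>j<N. 2 * C * real (l1 w) * real (card B) / real (Suc n))"
    proof (rule sum_mono)
      fix j
      show "\<bar>(\<Sum>u\<in>B. h (u - int j *s z - w)) - (\<Sum>u\<in>B. h (u - int j *s z))\<bar>
          \<le> 2 * C * real (l1 w) * real (card B) / real (Suc n)"
        using box[of "\<lambda>u. h (u - int j *s z)" C "- w"] h by (simp add: algebra_simps)
    qed
    also have "\<dots> = (2 * C * l1 w / real (Suc n)) * (real N * real (card B))" by simp
    finally have "\<bar>(\<Sum>j<N. (\<Sum>u\<in>B. h (u - int j *s z - w)) - (\<Sum>u\<in>B. h (u - int j *s z)))\<bar>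
        / (real N * real (card B)) \<le> 2 * C * l1 w / real (Suc n)"
      using cB N by (subst pos_divide_le_eq) auto
    moreover have "A (\<lambda>s. h (s - w)) - A h = (\<Sum>j<N. (\<Sum>u\<in>B. h (u - int j *s z - w))
        - (\<Sum>u\<in>B. h (u - int j *s z))) / (real N * real (card B))"
      by (simp add: A_def sum_subtractf diff_divide_distrib)
    ultimately show ?thesis using cB N by (simp add: abs_divide)
  qed
  define g where "g y \<omega> = A (\<lambda>s. T y s \<omega> - T 0 s \<omega>)" for y \<omega>
  have "approx_busemann z n g"
    unfolding approx_busemann_def
  proof (intro conjI ballI allI)
    fix y show "g y \<in> borel_measurable M"
      unfolding g_def A_def by measurable
  next
    fix \<omega> x \<alpha> assume *: "\<omega> \<in> space M" "\<alpha> \<in> (steps :: (int ^ 'd) set)"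
    show "g x \<omega> - g (x + \<alpha>) \<omega> \<le> \<tau> x \<alpha> \<omega>"
      unfolding g_def A_diff by (rule A_le) (use T_step[OF *] in simp)
  next
    fix \<omega> and y w :: "int ^ 'd" assume \<omega>: "\<omega> \<in> space M"
    \<comment> \<open>Shifting the environment by \<open>w\<close> amounts to shifting the target by
      \<open>- w\<close>, so the cocycle defect is the change of an average under translation.
      Unlike \<open>T\<close> itself, the increment \<open>?G\<close> is bounded uniformly in the
      target, so box averaging applies to it.\<close>
    let ?G = "\<lambda>s. T y s (V w \<omega>) - T 0 s (V w \<omega>)"
    have "T (y + w) s \<omega> - T 0 s \<omega> - (T w s \<omega> - T 0 s \<omega>) = ?G (s - w)" for s
      using T_shift[OF \<omega>, of y w "s - w"] T_shift[OF \<omega>, of 0 w "s - w"] by simp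
    then have "g (y + w) \<omega> - g w \<omega> = A (\<lambda>s. ?G (s - w))"
      unfolding g_def A_diff by simp
    moreover have "\<bar>A (\<lambda>s. ?G (s - w)) - A ?G\<bar> \<le> 2 * (b * l1 y) * l1 w / real (Suc n)"
      by (rule A_shift) (use T_lipschitz[of "V w \<omega>" y _ 0] \<omega> in simp)
    ultimately show "\<bar>g (y + w) \<omega> - g y (V w \<omega>) - g w \<omega>\<bar> \<le> 2 * b * l1 y * l1 w / real (Suc n)"
      by (simp add: g_def mult_ac)
  next
    have "expectation (g z) = A (\<lambda>s. t (z - s) - t (- s))"
      unfolding g_def A_def
      by (simp add: Bochner_Integration.integral_sum integrable_T expectation_T)
    also have "\<dots> = (\<Sum>u\<in>B. \<Sum>j<N. t (int (Suc j) *s z - u) - t (int j *s z - u))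
        / (real N * real (card B))"
    proof -
      have *: "z - (u - int j *s z) = int (Suc j) *s z - u" "- (u - int j *s z) = int j *s z - u" for u j
        by (simp_all add: vec_eq_iff algebra_simps)
      show ?thesis unfolding A_def by (subst sum.swap) (simp only: *)
    qed
    also have "(\<Sum>u\<in>B. \<Sum>j<N. t (int (Suc j) *s z - u) - t (int j *s z - u))
        = (\<Sum>u\<in>B. t (int N *s z - u) - t (- u))"
      by (subst sum_lessThan_telescope) simp
    also have "\<dots> / (real N * real (card B)) \<ge> m z - 2 * b / real (Suc n)"
    proof -
      have "real N * (m z - 2 * b / real (Suc n)) \<le> t (int N *s z - u) - t (- u)" if "u \<in> B" for u
      proof -
        have 1: "real N * m z \<le> t (int N *s z)"
          using m_le[of N z] N by (simp add: field_simps)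
        have 2: "t (int N *s z) \<le> t (int N *s z - u) + t u"
          using t_subadd[of "int N *s z - u" u] by simp
        have 3: "t u \<le> b * L" "t (- u) \<le> b * L"
        proof -
          have "b * l1 u \<le> b * L" using L[OF that] b_pos by (intro mult_left_mono) auto
          then show "t u \<le> b * L" "t (- u) \<le> b * L"
            using t_le_l1[of u] t_le_l1[of "- u"] by auto
        qed
        have "real L * real (Suc n) \<le> real N"
          unfolding N_def of_nat_mult[symmetric] of_nat_le_iff by simp
        then have "b * real L \<le> b * (real N / real (Suc n))"
          using b_pos by (intro mult_left_mono) (simp_all add: field_simps)
        then have 4: "2 * (b * L) \<le> real N * (2 * b / real (Suc n))" by (simp add: field_simps)
        show ?thesis unfolding right_diff_distrib using 1 2 3 4 by linarith
      qed
      then have "(\<Sum>u\<in>B. real N * (m z - 2 * b / real (Suc n))) \<le> (\<Sum>u\<in>B. t (int N *s z - u) - t (- u))"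
        by (rule sum_mono)
      then have "(m z - 2 * b / real (Suc n)) * (real N * real (card B))
          \<le> (\<Sum>u\<in>B. t (int N *s z - u) - t (- u))" by (simp add: mult_ac)
      then show ?thesis using cB N by (subst pos_le_divide_eq) auto
    qed
    finally show "m z - 2 * b / real (Suc n) \<le> expectation (g z)" .
  qed (simp add: g_def A_def)
  then show ?thesis by blast
qed

text \<open>\<open>F\<close> plays the role of a Busemann function in direction \<open>z\<close>:
  being a potential that vanishes at 0, it satisfies \<open>F (n z) \<le> T (n z) 0\<close>, and yet
  its mean at \<open>z\<close> reaches \<open>m z\<close>. The identity and the Lipschitz bound hold
  at every point of the sample space, so that later uses carry no exceptional set.\<close>

lemma busemann_exists:
  obtains F :: "int ^ 'd \<Rightarrow> 'w \<Rightarrow> real"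
  where "\<And>y. F y \<in> borel_measurable M"
    and "\<And>y w \<omega>. \<omega> \<in> space M \<Longrightarrow> F (y + w) \<omega> = F y (V w \<omega>) + F w \<omega>"
    and "\<And>x \<alpha> \<omega>. \<omega> \<in> space M \<Longrightarrow> \<alpha> \<in> steps \<Longrightarrow> F x \<omega> - F (x + \<alpha>) \<omega> \<le> \<tau> x \<alpha> \<omega>"
    and "m z \<le> expectation (F z)"
proof -
  \<comment> \<open>A fully supported \<open>Q\<close> and the weight \<open>1 + l1 y\<close> turn the approximants into bounded functions on one
    probability space, so that they converge almost surely for all \<open>y\<close> at once.\<close>
  define Q :: "(int ^ 'd) pmf" where "Q = map_pmf from_nat (geometric_pmf (1 / 2))"
  have Q: "set_pmf Q = UNIV"
    by (simp add: Q_def set_pmf_geometric)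
  interpret Q: prob_space "measure_pmf Q" by (rule prob_space_measure_pmf)
  interpret QM: pair_prob_space "measure_pmf Q" M ..
  define N where "N = measure_pmf Q \<Otimes>\<^sub>M M"
  have sp: "space N = UNIV \<times> space M" by (simp add: N_def space_pair_measure)
  have measN: "f \<in> borel_measurable N \<longleftrightarrow> (\<forall>y. (\<lambda>\<omega>. f (y, \<omega>)) \<in> borel_measurable M)"
    for f :: "(int ^ 'd) \<times> 'w \<Rightarrow> real"
  proof
    assume "f \<in> borel_measurable N"
    then show "\<forall>y. (\<lambda>\<omega>. f (y, \<omega>)) \<in> borel_measurable M"
      unfolding N_def by (intro allI measurable_Pair2[of f]) auto
  next
    assume "\<forall>y. (\<lambda>\<omega>. f (y, \<omega>)) \<in> borel_measurable M"
    then have "f \<in> borel_measurable (count_space UNIV \<Otimes>\<^sub>M M)"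
      by (intro measurable_pair_measure_countable1) auto
    moreover have "sets N = sets (count_space UNIV \<Otimes>\<^sub>M M)"
      unfolding N_def by (rule sets_pair_measure_cong) auto
    ultimately show "f \<in> borel_measurable N"
      using measurable_cong_sets[of N "count_space UNIV \<Otimes>\<^sub>M M" borel borel] by simp
  qed
  define unscale where "unscale f = (\<lambda>y \<omega>. f (y, \<omega>) * (1 + real (l1 y)))"
    for f :: "(int ^ 'd) \<times> 'w \<Rightarrow> real"
  have pos: "1 + real (l1 y) > 0" for y :: "int ^ 'd" by (simp add: add_pos_nonneg)
  obtain f where f: "\<And>n. approx_busemann z n (unscale (f n))"
    and f_lim: "AE p in N. convergent (\<lambda>n. f n p)"
  proof (rule prob_space.midpoint_convex_AE_convergent
      [of N "\<lambda>n f. approx_busemann z n (unscale f)" b])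
    show "prob_space N" unfolding N_def by (rule QM.prob_space_axioms)
  next
    fix n f assume *: "approx_busemann z n (unscale f)"
    show "f \<in> borel_measurable N"
      unfolding measN
    proof
      fix y
      have "(\<lambda>\<omega>. unscale f y \<omega> / (1 + real (l1 y))) \<in> borel_measurable M"
        using * by (intro borel_measurable_divide) (auto simp: approx_busemann_def)
      then show "(\<lambda>\<omega>. f (y, \<omega>)) \<in> borel_measurable M"
        using pos[of y] by (simp add: unscale_def)
    qed
    fix p assume "p \<in> space N"
    then obtain y \<omega> where p: "p = (y, \<omega>)" "\<omega> \<in> space M" by (auto simp: sp)
    have "\<bar>f p\<bar> * (1 + real (l1 y)) \<le> b * l1 y"
      using approx_busemann_bound[OF * p(2), of y] pos[of y] by (simp add: unscale_def p abs_mult)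
    also have "\<dots> \<le> b * (1 + real (l1 y))" using b_pos by simp
    finally show "\<bar>f p\<bar> \<le> b" using pos[of y] by simp
  next
    fix n
    obtain g where g: "approx_busemann z n g" using approx_busemann_exists by blast
    have "unscale (\<lambda>(y, \<omega>). g y \<omega> / (1 + real (l1 y))) = g"
      using pos by (intro ext) (simp add: unscale_def less_imp_neq[THEN not_sym])
    then show "\<exists>f. approx_busemann z n (unscale f)" using g by metis
  next
    fix n f g assume "approx_busemann z n (unscale f)" "approx_busemann z n (unscale g)"
    from approx_busemann_midpoint[OF this]
    show "approx_busemann z n (unscale (\<lambda>p. (f p + g p) / 2))"
      by (simp add: unscale_def distrib_right)
  qed (blast intro: approx_busemann_antimono)+
  define g where "g n = unscale (f n)" for n
  have g: "approx_busemann z n (g n)" for n using f by (simp add: g_def)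
  have [measurable]: "g n y \<in> borel_measurable M" for n y
    using g[of n] by (simp add: approx_busemann_def)
  have "AE y in measure_pmf Q. AE \<omega> in M. convergent (\<lambda>n. f n (y, \<omega>))"
    using QM.AE_pair f_lim unfolding N_def by blast
  then have "AE \<omega> in M. convergent (\<lambda>n. f n (y, \<omega>))" for y
    by (simp add: AE_measure_pmf_iff Q)
  then have conv: "AE \<omega> in M. convergent (\<lambda>n. g n y \<omega>)" for y
  proof (rule eventually_mono)
    fix \<omega> assume "convergent (\<lambda>n. f n (y, \<omega>))"
    then show "convergent (\<lambda>n. g n y \<omega>)"
      unfolding g_def unscale_def by (intro convergent_mult convergent_const)
  qed
  \<comment> \<open>Convergence is required along the whole orbit of \<omega>, which makes
    \<open>G\<close> invariant. Setting \<open>F\<close> to 0 off \<open>G\<close> then preserves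
    the cocycle identity, and also the Lipschitz bound because the weights are nonnegative.\<close>
  define G where "G = {\<omega>\<in>space M. \<forall>w y. Cauchy (\<lambda>n. g n y (V w \<omega>))}"
  have [measurable]: "(\<lambda>\<omega>. g n y (V w \<omega>)) \<in> borel_measurable M" for n y w
    by (rule measurable_compose[OF measurable_V]) measurable
  have [measurable]: "G \<in> sets M"
    unfolding G_def by (intro sets.sets_Collect_countable_All sets_Collect_Cauchy) fact
  have AE_G: "AE \<omega> in M. \<omega> \<in> G"
  proof -
    have "AE \<omega> in M. \<forall>w y. Cauchy (\<lambda>n. g n y (V w \<omega>))"
      unfolding AE_all_countable using AE_V[OF conv] by (simp add: Cauchy_convergent_iff)
    then show ?thesis using AE_space by eventually_elim (simp add: G_def)
  qed
  have G_space: "\<omega> \<in> space M" if "\<omega> \<in> G" for \<omega> using that by (simp add: G_def)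
  have G_V: "V x \<omega> \<in> G \<longleftrightarrow> \<omega> \<in> G" if \<omega>: "\<omega> \<in> space M" for x \<omega>
  proof -
    have imp: "V x \<omega> \<in> G" if "\<omega> \<in> G" for x \<omega>
    proof -
      have "V w (V x \<omega>) = V (w + x) \<omega>" for w
        using group_law[OF G_space[OF that]] by simp
      then show ?thesis using that by (simp add: G_def)
    qed
    show ?thesis using imp[of \<omega> x] imp[of "V x \<omega>" "- x"] \<omega> by auto
  qed
  define F where "F y \<omega> = (if \<omega> \<in> G then lim (\<lambda>n. g n y \<omega>) else 0)" for y \<omega>
  have F_lim: "(\<lambda>n. g n y \<omega>) \<longlonglongrightarrow> F y \<omega>" if "\<omega> \<in> G" for y \<omega>
  proof -
    have "Cauchy (\<lambda>n. g n y (V 0 \<omega>))" using that unfolding G_def by blast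
    then have "convergent (\<lambda>n. g n y \<omega>)"
      using G_space[OF that] by (simp add: Cauchy_convergent_iff)
    then show ?thesis using that by (simp add: F_def convergent_LIMSEQ_iff)
  qed
  have F_meas [measurable]: "F y \<in> borel_measurable M" for y
  proof (rule borel_measurable_LIMSEQ_real[where u = "\<lambda>n \<omega>. if \<omega> \<in> G then g n y \<omega> else 0"])
    fix \<omega>
    show "(\<lambda>n. if \<omega> \<in> G then g n y \<omega> else 0) \<longlonglongrightarrow> F y \<omega>"
      using F_lim by (cases "\<omega> \<in> G") (auto simp: F_def)
  qed measurable
  show ?thesis
  proof
    fix y show "F y \<in> borel_measurable M" by (rule F_meas)
  next
    fix y w :: "int ^ 'd" and \<omega> assume \<omega>: "\<omega> \<in> space M"
    show "F (y + w) \<omega> = F y (V w \<omega>) + F w \<omega>"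
    proof (cases "\<omega> \<in> G")
      case True
      have "(\<lambda>n. g n (y + w) \<omega> - g n y (V w \<omega>) - g n w \<omega>)
          \<longlonglongrightarrow> F (y + w) \<omega> - F y (V w \<omega>) - F w \<omega>"
        using True G_V[OF \<omega>] by (intro tendsto_diff F_lim) auto
      moreover have "(\<lambda>n. g n (y + w) \<omega> - g n y (V w \<omega>) - g n w \<omega>) \<longlonglongrightarrow> 0"
      proof (rule Lim_null_comparison)
        have "\<bar>g n (y + w) \<omega> - g n y (V w \<omega>) - g n w \<omega>\<bar> \<le> 2 * b * l1 y * l1 w / real (Suc n)" for n
          using g[of n] \<omega> unfolding approx_busemann_def by blast
        then show "\<forall>\<^sub>F n in sequentially. norm (g n (y + w) \<omega> - g n y (V w \<omega>) - g n w \<omega>)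
            \<le> 2 * b * l1 y * l1 w / real (Suc n)"
          by simp
        show "(\<lambda>n. 2 * b * l1 y * l1 w / real (Suc n)) \<longlonglongrightarrow> 0"
          using tendsto_mult_right_zero[OF LIMSEQ_inverse_real_of_nat, of "2 * b * l1 y * l1 w"]
          by (simp add: field_simps)
      qed
      ultimately show ?thesis using LIMSEQ_unique by fastforce
    next
      case False
      then show ?thesis using G_V[OF \<omega>] by (simp add: F_def)
    qed
  next
    fix x \<alpha> \<omega> assume *: "\<omega> \<in> space M" "\<alpha> \<in> (steps :: (int ^ 'd) set)"
    show "F x \<omega> - F (x + \<alpha>) \<omega> \<le> \<tau> x \<alpha> \<omega>"
    proof (cases "\<omega> \<in> G")
      case True
      have "(\<lambda>n. g n x \<omega> - g n (x + \<alpha>) \<omega>) \<longlonglongrightarrow> F x \<omega> - F (x + \<alpha>) \<omega>"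
        using True by (intro tendsto_diff F_lim)
      moreover have "g n x \<omega> - g n (x + \<alpha>) \<omega> \<le> \<tau> x \<alpha> \<omega>" for n
        using g[of n] * by (simp add: approx_busemann_def)
      ultimately show ?thesis by (intro LIMSEQ_le_const2) auto
    next
      case False
      then show ?thesis using weight_nonneg * by (simp add: F_def)
    qed
  next
    have "(\<lambda>n. expectation (g n z)) \<longlonglongrightarrow> expectation (F z)"
    proof (rule integral_dominated_convergence[where w = "\<lambda>_. b * l1 z"])
      show "AE \<omega> in M. (\<lambda>n. g n z \<omega>) \<longlonglongrightarrow> F z \<omega>"
        using AE_G by eventually_elim (rule F_lim)
    qed (use approx_busemann_bound[OF g] in auto)
    moreover have "(\<lambda>n. m z - 2 * b / real (Suc n)) \<longlonglongrightarrow> m z - 0"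
      using tendsto_mult_right_zero[OF LIMSEQ_inverse_real_of_nat, of "2 * b"]
      by (intro tendsto_diff tendsto_const) (simp add: field_simps)
    moreover have "m z - 2 * b / real (Suc n) \<le> expectation (g n z)" for n
      using g[of n] by (simp add: approx_busemann_def)
    ultimately show "m z \<le> expectation (F z)"
      by (intro LIMSEQ_le[of "\<lambda>n. m z - 2 * b / real (Suc n)" "m z"]) auto
  qed
qed

end

section \<open>Slopes of test functions and the time constant\<close>

lemma discrete_deriv_linear:
  "discrete_deriv \<alpha> (\<lambda>x \<omega>. c * \<phi> x \<omega> + d * \<psi> x \<omega>) x \<omega>
    = c * discrete_deriv \<alpha> \<phi> x \<omega> + d * discrete_deriv \<alpha> \<psi> x \<omega>"
  by (simp add: discrete_deriv_def algebra_simps)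

context ergodic_action
begin

lemma test_function_deriv:
  assumes \<phi>: "\<phi> \<in> test_functions M V" and \<alpha>: "\<alpha> \<in> steps"
  shows test_function_deriv_measurable: "discrete_deriv \<alpha> \<phi> x \<in> borel_measurable M"
    and test_function_deriv_bounded: "\<exists>C. AE \<omega> in M. \<bar>discrete_deriv \<alpha> \<phi> 0 \<omega>\<bar> \<le> C"
    and test_function_deriv_integrable: "integrable M (discrete_deriv \<alpha> \<phi> x)"
    and test_function_deriv_mean: "expectation (discrete_deriv \<alpha> \<phi> x) = 0"
proof -
  let ?D = "discrete_deriv \<alpha> \<phi>"
  have meas: "?D x \<in> borel_measurable M" and mean: "expectation (?D 0) = 0"
    and bd: "esssup M (\<lambda>\<omega>. ereal \<bar>?D 0 \<omega>\<bar>) < \<infinity>" for x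
    using \<phi> \<alpha> by (auto simp: test_functions_def)
  show "?D x \<in> borel_measurable M" by (rule meas)
  obtain C where C: "esssup M (\<lambda>\<omega>. ereal \<bar>?D 0 \<omega>\<bar>) < ereal C"
    using bd less_PInf_Ex_of_nat[of "esssup M (\<lambda>\<omega>. ereal \<bar>?D 0 \<omega>\<bar>)"] by auto
  have AE: "AE \<omega> in M. \<bar>?D 0 \<omega>\<bar> \<le> C"
    using esssup_AE[where M = M and f = "\<lambda>\<omega>. ereal \<bar>?D 0 \<omega>\<bar>"]
  proof eventually_elim
    case (elim \<omega>)
    then have "ereal \<bar>?D 0 \<omega>\<bar> < ereal C" using C by (rule le_less_trans)
    then show ?case by simp
  qed
  then show "\<exists>C. AE \<omega> in M. \<bar>?D 0 \<omega>\<bar> \<le> C" by blast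
  have int: "integrable M (?D 0)"
    by (rule integrable_const_bound[OF _ meas, where B = C]) (use AE in simp)
  have eq: "?D x \<omega> = ?D 0 (V x \<omega>)" if "\<omega> \<in> space M" for \<omega>
  proof -
    have "?D (0 + x) \<omega> = ?D 0 (V x \<omega>)"
      using \<phi> \<alpha> that unfolding test_functions_def by blast
    then show ?thesis by simp
  qed
  show "integrable M (?D x)"
    using integrable_V[OF int, of x] by (subst Bochner_Integration.integrable_cong[OF refl eq])
  show "expectation (?D x) = 0"
    using expectation_V[of "?D 0" x, OF meas] mean
    by (subst Bochner_Integration.integral_cong[OF refl eq]) auto
qed

lemma test_function_linear:
  assumes \<phi>: "\<phi> \<in> test_functions M V" and \<psi>: "\<psi> \<in> test_functions M V"
  shows "(\<lambda>x \<omega>. c * \<phi> x \<omega> + d * \<psi> x \<omega>) \<in> test_functions M V"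
  unfolding test_functions_def mem_Collect_eq
proof (intro conjI ballI allI)
  fix \<alpha> x assume \<alpha>: "\<alpha> \<in> (steps :: (int ^ 'd) set)"
  note [measurable] = test_function_deriv_measurable[OF \<phi> \<alpha>] test_function_deriv_measurable[OF \<psi> \<alpha>]
  show meas: "discrete_deriv \<alpha> (\<lambda>x \<omega>. c * \<phi> x \<omega> + d * \<psi> x \<omega>) x \<in> borel_measurable M" for x
    unfolding discrete_deriv_linear by measurable
  obtain C C' where C: "AE \<omega> in M. \<bar>discrete_deriv \<alpha> \<phi> 0 \<omega>\<bar> \<le> C"
    and C': "AE \<omega> in M. \<bar>discrete_deriv \<alpha> \<psi> 0 \<omega>\<bar> \<le> C'"
    using test_function_deriv_bounded[OF \<phi> \<alpha>] test_function_deriv_bounded[OF \<psi> \<alpha>] by blast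
  have "esssup M (\<lambda>\<omega>. ereal \<bar>discrete_deriv \<alpha> (\<lambda>x \<omega>. c * \<phi> x \<omega> + d * \<psi> x \<omega>) 0 \<omega>\<bar>)
      \<le> ereal (\<bar>c\<bar> * C + \<bar>d\<bar> * C')"
  proof (rule esssup_I)
    show "(\<lambda>\<omega>. ereal \<bar>discrete_deriv \<alpha> (\<lambda>x \<omega>. c * \<phi> x \<omega> + d * \<psi> x \<omega>) 0 \<omega>\<bar>) \<in> borel_measurable M"
      using meas[of 0] by measurable
    show "AE \<omega> in M. ereal \<bar>discrete_deriv \<alpha> (\<lambda>x \<omega>. c * \<phi> x \<omega> + d * \<psi> x \<omega>) 0 \<omega>\<bar>
        \<le> ereal (\<bar>c\<bar> * C + \<bar>d\<bar> * C')"
      using C C'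
    proof eventually_elim
      case (elim \<omega>)
      show ?case
        unfolding discrete_deriv_linear ereal_less_eq
        using mult_left_mono[OF elim(1), of "\<bar>c\<bar>"] mult_left_mono[OF elim(2), of "\<bar>d\<bar>"]
          abs_triangle_ineq[of "c * discrete_deriv \<alpha> \<phi> 0 \<omega>" "d * discrete_deriv \<alpha> \<psi> 0 \<omega>"]
        by (simp add: abs_mult)
    qed
  qed
  then show "esssup M (\<lambda>\<omega>. ereal \<bar>discrete_deriv \<alpha> (\<lambda>x \<omega>. c * \<phi> x \<omega> + d * \<psi> x \<omega>) 0 \<omega>\<bar>) < \<infinity>"
    by (rule le_less_trans) simp
  show "expectation (discrete_deriv \<alpha> (\<lambda>x \<omega>. c * \<phi> x \<omega> + d * \<psi> x \<omega>) 0) = 0"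
    unfolding discrete_deriv_linear
    using test_function_deriv_integrable[OF \<phi> \<alpha>] test_function_deriv_integrable[OF \<psi> \<alpha>]
      test_function_deriv_mean[OF \<phi> \<alpha>] test_function_deriv_mean[OF \<psi> \<alpha>]
    by simp
next
  fix \<alpha> x z \<omega> assume "\<alpha> \<in> (steps :: (int ^ 'd) set)" "\<omega> \<in> space M"
  then have "discrete_deriv \<alpha> \<phi> (x + z) \<omega> = discrete_deriv \<alpha> \<phi> x (V z \<omega>)"
    "discrete_deriv \<alpha> \<psi> (x + z) \<omega> = discrete_deriv \<alpha> \<psi> x (V z \<omega>)"
    using \<phi> \<psi> unfolding test_functions_def by blast+
  then show "discrete_deriv \<alpha> (\<lambda>x \<omega>. c * \<phi> x \<omega> + d * \<psi> x \<omega>) (x + z) \<omega>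
      = discrete_deriv \<alpha> (\<lambda>x \<omega>. c * \<phi> x \<omega> + d * \<psi> x \<omega>) x (V z \<omega>)"
    unfolding discrete_deriv_linear by simp
qed

lemma test_function_scale:
  assumes "\<phi> \<in> test_functions M V"
  shows "(\<lambda>x \<omega>. c * \<phi> x \<omega>) \<in> test_functions M V"
  using test_function_linear[OF assms assms, of c 0] by simp

lemma zero_test_function: "(\<lambda>_ _. 0) \<in> test_functions M V"
proof -
  have "esssup M (\<lambda>_. 0 :: ereal) = 0"
    by (rule esssup_const) (simp add: emeasure_space_1)
  moreover have "discrete_deriv \<alpha> (\<lambda>_ _. 0) x = (\<lambda>_ :: 'w. 0)" for \<alpha> x :: "int ^ 'd"
    by (simp add: discrete_deriv_def fun_eq_iff)
  ultimately show ?thesis by (simp add: test_functions_def zero_ereal_def)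
qed

text \<open>Membership in \<open>test_functions\<close> controls only the derivatives of \<phi>, so
  the claim concerns an increment and is proved by adding derivatives along a lattice path from
  0.\<close>

lemma test_function_mean:
  assumes \<phi>: "\<phi> \<in> test_functions M V"
  shows "integrable M (\<lambda>\<omega>. \<phi> x \<omega> - \<phi> 0 \<omega>)"
    and "expectation (\<lambda>\<omega>. \<phi> x \<omega> - \<phi> 0 \<omega>) = 0"
proof -
  have "integrable M (\<lambda>\<omega>. \<phi> x \<omega> - \<phi> 0 \<omega>) \<and> expectation (\<lambda>\<omega>. \<phi> x \<omega> - \<phi> 0 \<omega>) = 0"
  proof (induction x rule: lattice_induct)
    case (step x \<alpha>)
    have eq: "(\<lambda>\<omega>. \<phi> (x + \<alpha>) \<omega> - \<phi> 0 \<omega>)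
        = (\<lambda>\<omega>. discrete_deriv \<alpha> \<phi> x \<omega> + (\<phi> x \<omega> - \<phi> 0 \<omega>))"
      by (simp add: discrete_deriv_def)
    note D = test_function_deriv_integrable[OF \<phi> step(1)] test_function_deriv_mean[OF \<phi> step(1)]
    have IH: "integrable M (\<lambda>\<omega>. \<phi> x \<omega> - \<phi> 0 \<omega>)" "expectation (\<lambda>\<omega>. \<phi> x \<omega> - \<phi> 0 \<omega>) = 0"
      using step by blast+
    show ?case
      unfolding eq Bochner_Integration.integral_add[OF D(1) IH(1)]
      using Bochner_Integration.integrable_add[OF D(1) IH(1)] D(2) IH(2) by simp
  qed simp
  then show "integrable M (\<lambda>\<omega>. \<phi> x \<omega> - \<phi> 0 \<omega>)" "expectation (\<lambda>\<omega>. \<phi> x \<omega> - \<phi> 0 \<omega>) = 0"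
    by blast+
qed

end

section \<open>Slopes of potentials, and limits along lattice directions\<close>

context bounded_percolation
begin

definition K :: "(real ^ 'd) set"
  where "K = {p. \<exists>\<phi>\<in>test_functions M V. AE \<omega> in M. \<forall>x. \<forall>\<alpha>\<in>steps.
    - discrete_deriv \<alpha> \<phi> x \<omega> - p \<bullet> real_vec \<alpha> \<le> \<tau> x \<alpha> \<omega>}"

text \<open>Adding \<open>p \<bullet> x\<close> to the test function yields a potential, whose
  increment from 0 to \<open>z\<close> is at most \<open>T z 0\<close>. Taking means removes the
  contribution of the test function.\<close>

lemma K_le_t:
  assumes "p \<in> K"
  shows "p \<bullet> real_vec z \<le> t z"
proof -
  obtain \<phi> where \<phi>: "\<phi> \<in> test_functions M V"
    and le: "AE \<omega> in M. \<forall>x. \<forall>\<alpha>\<in>steps. - discrete_deriv \<alpha> \<phi> x \<omega> - p \<bullet> real_vec \<alpha> \<le> \<tau> x \<alpha> \<omega>"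
    using assms by (auto simp: K_def)
  note mean = test_function_mean[OF \<phi>]
  have "p \<bullet> real_vec z = expectation (\<lambda>\<omega>. (\<phi> z \<omega> - \<phi> 0 \<omega>) + p \<bullet> real_vec z)"
    using mean[of z] by (subst Bochner_Integration.integral_add) (auto simp: prob_space)
  also have "\<dots> \<le> expectation (T z 0)"
  proof (rule integral_mono_AE)
    show "AE \<omega> in M. (\<phi> z \<omega> - \<phi> 0 \<omega>) + p \<bullet> real_vec z \<le> T z 0 \<omega>"
      using le
    proof eventually_elim
      case (elim \<omega>)
      have "(\<phi> z \<omega> + p \<bullet> real_vec z) - (\<phi> 0 \<omega> + p \<bullet> real_vec 0) \<le> T z 0 \<omega>"
        by (rule passage_time_ge_potential)
          (use elim in \<open>simp add: discrete_deriv_def real_vec_add inner_add_right algebra_simps\<close>)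
      then show ?case by simp
    qed
  qed (use mean[of z] integrable_T in auto)
  finally show ?thesis by (simp add: t_def)
qed

lemma K_le_m:
  assumes "p \<in> K"
  shows "p \<bullet> real_vec z \<le> m z"
  unfolding m_def
proof (rule cINF_greatest)
  fix k :: nat assume "k \<in> {0<..}"
  then show "p \<bullet> real_vec z \<le> t (int k *s z) / real k"
    using K_le_t[OF assms, of "int k *s z"] by (simp add: real_vec_scale field_simps)
qed auto

lemma cocycle_bound:
  assumes cocycle: "\<And>y w \<omega>. \<omega> \<in> space M \<Longrightarrow> F (y + w) \<omega> = F y (V w \<omega>) + F w \<omega>"
    and lip: "\<And>x \<alpha> \<omega>. \<omega> \<in> space M \<Longrightarrow> \<alpha> \<in> steps \<Longrightarrow> F x \<omega> - F (x + \<alpha>) \<omega> \<le> \<tau> x \<alpha> \<omega>"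
    and \<omega>: "\<omega> \<in> space M"
  shows "\<bar>F x \<omega>\<bar> \<le> b * l1 x"
proof (rule lipschitz_bound[OF \<omega>, of "\<lambda>x. F x \<omega>"])
  show "F 0 \<omega> = 0" using cocycle[OF \<omega>, of 0 0] \<omega> by simp
qed (rule lip[OF \<omega>])

lemma cocycle_integrable:
  assumes meas: "\<And>y. F y \<in> borel_measurable M"
    and cocycle: "\<And>y w \<omega>. \<omega> \<in> space M \<Longrightarrow> F (y + w) \<omega> = F y (V w \<omega>) + F w \<omega>"
    and lip: "\<And>x \<alpha> \<omega>. \<omega> \<in> space M \<Longrightarrow> \<alpha> \<in> steps \<Longrightarrow> F x \<omega> - F (x + \<alpha>) \<omega> \<le> \<tau> x \<alpha> \<omega>"
  shows "integrable M (F x)"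
proof (rule integrable_const_bound[OF _ meas, where B = "b * l1 x"])
  show "AE \<omega> in M. norm (F x \<omega>) \<le> b * l1 x"
    unfolding real_norm_def by (rule AE_I2, rule cocycle_bound) (use cocycle lip in auto)
qed

text \<open>Measure preservation makes the mean of a stationary cocycle additive in
  \<open>x\<close>, hence linear with some slope \<open>q\<close>. Subtracting
  \<open>q \<bullet> x\<close> centers \<open>F\<close> into a test function, and the Lipschitz
  bound for \<open>F\<close> becomes the condition defining \<open>K\<close>.\<close>

lemma cocycle_mean_in_K:
  assumes meas: "\<And>y. F y \<in> borel_measurable M"
    and cocycle: "\<And>y w \<omega>. \<omega> \<in> space M \<Longrightarrow> F (y + w) \<omega> = F y (V w \<omega>) + F w \<omega>"
    and lip: "\<And>x \<alpha> \<omega>. \<omega> \<in> space M \<Longrightarrow> \<alpha> \<in> steps \<Longrightarrow> F x \<omega> - F (x + \<alpha>) \<omega> \<le> \<tau> x \<alpha> \<omega>"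
  shows "\<exists>q\<in>K. \<forall>x. expectation (F x) = q \<bullet> real_vec x"
proof -
  have bd: "\<bar>F x \<omega>\<bar> \<le> b * l1 x" if "\<omega> \<in> space M" for x \<omega>
    using cocycle_bound[of F \<omega> x] cocycle lip that by blast
  have int: "integrable M (F x)" for x
    by (rule cocycle_integrable; fact meas cocycle lip)
  have add: "expectation (F (x + y)) = expectation (F x) + expectation (F y)" for x y
  proof -
    have "expectation (F (x + y)) = expectation (\<lambda>\<omega>. F x (V y \<omega>) + F y \<omega>)"
      by (intro Bochner_Integration.integral_cong) (auto simp: cocycle)
    then show ?thesis using integrable_V[OF int] int expectation_V[OF meas] by simp
  qed
  define q :: "real ^ 'd" where "q = (\<chi> i. expectation (F (axis i 1)))"
  have mean: "expectation (F x) = q \<bullet> real_vec x" for x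
    unfolding q_def by (rule additive_imp_inner) (rule add)
  define \<phi> where "\<phi> x \<omega> = F x \<omega> - q \<bullet> real_vec x" for x \<omega>
  have D: "discrete_deriv \<alpha> \<phi> x \<omega> = F (x + \<alpha>) \<omega> - F x \<omega> - q \<bullet> real_vec \<alpha>" for \<alpha> x \<omega>
    by (simp add: discrete_deriv_def \<phi>_def real_vec_add inner_add_right)
  have D': "discrete_deriv \<alpha> \<phi> x \<omega> = F \<alpha> (V x \<omega>) - q \<bullet> real_vec \<alpha>" if "\<omega> \<in> space M" for \<alpha> x \<omega>
    unfolding D using cocycle[OF that, of \<alpha> x] by (simp add: add.commute)
  have "\<phi> \<in> test_functions M V"
    unfolding test_functions_def mem_Collect_eq
  proof (intro conjI ballI allI)
    fix \<alpha> x show "discrete_deriv \<alpha> \<phi> x \<in> borel_measurable M"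
      unfolding D using meas by measurable
  next
    fix \<alpha> x z \<omega> assume "\<omega> \<in> space M"
    then show "discrete_deriv \<alpha> \<phi> (x + z) \<omega> = discrete_deriv \<alpha> \<phi> x (V z \<omega>)"
      by (simp add: D' group_law)
  next
    fix \<alpha> :: "int ^ 'd"
    have "esssup M (\<lambda>\<omega>. ereal \<bar>discrete_deriv \<alpha> \<phi> 0 \<omega>\<bar>) \<le> ereal (b * l1 \<alpha> + \<bar>q \<bullet> real_vec \<alpha>\<bar>)"
    proof (rule esssup_I)
      show "(\<lambda>\<omega>. ereal \<bar>discrete_deriv \<alpha> \<phi> 0 \<omega>\<bar>) \<in> borel_measurable M"
        unfolding D using meas by measurable
      show "AE \<omega> in M. ereal \<bar>discrete_deriv \<alpha> \<phi> 0 \<omega>\<bar> \<le> ereal (b * l1 \<alpha> + \<bar>q \<bullet> real_vec \<alpha>\<bar>)"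
      proof (rule AE_I2)
        fix \<omega> assume \<omega>: "\<omega> \<in> space M"
        show "ereal \<bar>discrete_deriv \<alpha> \<phi> 0 \<omega>\<bar> \<le> ereal (b * l1 \<alpha> + \<bar>q \<bullet> real_vec \<alpha>\<bar>)"
          using bd[OF \<omega>, of \<alpha>] by (simp add: D'[OF \<omega>] \<omega>)
      qed
    qed
    then show "esssup M (\<lambda>\<omega>. ereal \<bar>discrete_deriv \<alpha> \<phi> 0 \<omega>\<bar>) < \<infinity>"
      by (rule le_less_trans) simp
    have "expectation (discrete_deriv \<alpha> \<phi> 0) = expectation (\<lambda>\<omega>. F \<alpha> \<omega> - q \<bullet> real_vec \<alpha>)"
      by (intro Bochner_Integration.integral_cong) (auto simp: D')
    then show "expectation (discrete_deriv \<alpha> \<phi> 0) = 0"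
      using int mean by (simp add: prob_space)
  qed
  moreover have "AE \<omega> in M. \<forall>x. \<forall>\<alpha>\<in>steps. - discrete_deriv \<alpha> \<phi> x \<omega> - q \<bullet> real_vec \<alpha> \<le> \<tau> x \<alpha> \<omega>"
    by (rule AE_I2) (use lip in \<open>simp add: D\<close>)
  ultimately have "q \<in> K" unfolding K_def by blast
  then show ?thesis using mean by blast
qed

text \<open>The shift moves both endpoints by \<open>y\<close>, at a cost of at most
  \<open>b l1 y\<close> each, which is negligible against \<open>n\<close>. This makes the upper and
  lower limits of \<open>T (n z) 0 / n\<close> invariant under every shift.\<close>

lemma rescaled_passage_time_shift:
  assumes \<omega>: "\<omega> \<in> space M"
  shows "(\<lambda>n. ereal (T (int n *s z) 0 (V y \<omega>) / n - T (int n *s z) 0 \<omega> / n)) \<longlonglongrightarrow> 0"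
proof -
  have bd: "\<bar>T (int n *s z) 0 (V y \<omega>) - T (int n *s z) 0 \<omega>\<bar> \<le> 2 * b * l1 y" for n
  proof -
    have "T (int n *s z) 0 (V y \<omega>) = T (int n *s z + y) y \<omega>"
      using T_shift[OF \<omega>, of "int n *s z" y 0] by simp
    moreover have "\<bar>T (int n *s z + y) y \<omega> - T (int n *s z) y \<omega>\<bar> \<le> b * l1 y"
      using T_lipschitz[OF \<omega>, of "int n *s z + y" y "int n *s z"] by simp
    moreover have "\<bar>T (int n *s z) y \<omega> - T (int n *s z) 0 \<omega>\<bar> \<le> b * l1 y"
      using T_triangle[OF \<omega>, of "int n *s z" y 0] T_triangle[OF \<omega>, of "int n *s z" 0 y]
        T_le_l1[OF \<omega>, of y 0] T_le_l1[OF \<omega>, of 0 y] by simp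
    ultimately show ?thesis by linarith
  qed
  have "(\<lambda>n. T (int n *s z) 0 (V y \<omega>) / n - T (int n *s z) 0 \<omega> / n) \<longlonglongrightarrow> 0"
  proof (rule Lim_null_comparison)
    have "\<bar>T (int n *s z) 0 (V y \<omega>) / n - T (int n *s z) 0 \<omega> / n\<bar> \<le> 2 * b * l1 y / n" for n
      using divide_right_mono[OF bd[of n], of "real n"]
      by (simp add: diff_divide_distrib[symmetric])
    then show "\<forall>\<^sub>F n in sequentially. norm (T (int n *s z) 0 (V y \<omega>) / n - T (int n *s z) 0 \<omega> / n)
        \<le> 2 * b * l1 y / n"
      by simp
    show "(\<lambda>n. 2 * b * l1 y / real n) \<longlonglongrightarrow> 0" by (rule lim_const_over_n)
  qed
  then show ?thesis unfolding zero_ereal_def by (rule tendsto_ereal)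
qed

text \<open>The upper limit is almost surely a constant \<open>c\<close>. If
  \<open>t z < r < c\<close>, then almost surely \<open>T (n z) 0\<close> exceeds \<open>n r\<close>
  for some \<open>n\<close>, and the maximal inequality for \<open>T z 0 - r\<close> along
  \<open>V z\<close> yields \<open>r \<le> t z\<close>.\<close>

lemma limsup_le_t: "AE \<omega> in M. limsup (\<lambda>n. ereal (T (int n *s z) 0 \<omega> / n)) \<le> t z"
proof -
  let ?X = "\<lambda>\<omega>. limsup (\<lambda>n. ereal (T (int n *s z) 0 \<omega> / n))"
  have meas: "?X \<in> borel_measurable M" by measurable
  have inv: "?X (V y \<omega>) = ?X \<omega>" if "\<omega> \<in> space M" for y \<omega>
  proof -
    have "?X (V y \<omega>) = limsup (\<lambda>n. ereal (T (int n *s z) 0 (V y \<omega>) / n - T (int n *s z) 0 \<omega> / n)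
        + ereal (T (int n *s z) 0 \<omega> / n))"
      by simp
    also have "\<dots> = 0 + ?X \<omega>"
      by (rule ereal_limsup_lim_add[OF rescaled_passage_time_shift[OF that]]) simp
    finally show ?thesis by simp
  qed
  obtain c where c: "AE \<omega> in M. ?X \<omega> = c"
    using invariant_imp_AE_const[of ?X, OF meas inv] by blast
  have "c \<le> t z"
  proof (rule ccontr)
    assume "\<not> c \<le> t z"
    then obtain r where r: "t z < r" "ereal r < c"
      using ereal_dense2[of "ereal (t z)" c] by (auto simp: not_le)
    have "expectation (\<lambda>\<omega>. T z 0 \<omega> - r) \<ge> 0"
    proof (rule maximal_ergodic[where U = "V z" and s = "\<lambda>n \<omega>. T (int n *s z) 0 \<omega> - real n * r"])
      fix n \<omega> assume \<omega>: "\<omega> \<in> space M"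
      have eq: "int (Suc n) *s z = int n *s z + z" by (simp add: vec_eq_iff algebra_simps)
      have "T (int n *s z + z) 0 \<omega> \<le> T (int n *s z) 0 (V z \<omega>) + T z 0 \<omega>"
        using T_triangle[OF \<omega>, of "int n *s z + z" 0 z] T_shift[OF \<omega>, of "int n *s z" z 0] by simp
      then show "T (int (Suc n) *s z) 0 \<omega> - real (Suc n) * r
          \<le> T z 0 \<omega> - r + (T (int n *s z) 0 (V z \<omega>) - real n * r)"
        unfolding eq by (simp add: distrib_right)
    next
      show "AE \<omega> in M. \<exists>n. T (int n *s z) 0 \<omega> - real n * r > 0"
        using c
      proof eventually_elim
        case (elim \<omega>)
        show ?case
        proof (rule ccontr)
          assume neg: "\<nexists>n. T (int n *s z) 0 \<omega> - real n * r > 0"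
          have "?X \<omega> \<le> ereal r"
          proof (rule Limsup_bounded)
            show "\<forall>\<^sub>F n in sequentially. ereal (T (int n *s z) 0 \<omega> / n) \<le> ereal r"
              using eventually_gt_at_top[of 0]
            proof eventually_elim
              case (elim n)
              have "T (int n *s z) 0 \<omega> \<le> real n * r" using neg by (simp add: not_less)
              then show ?case using elim by (simp add: field_simps)
            qed
          qed
          then show False using elim r(2) by simp
        qed
      qed
    qed (auto simp: measurable_V measure_preserving integrable_T)
    then show False using r(1) by (simp add: integrable_T prob_space t_def[symmetric])
  qed
  then show ?thesis using c by (auto elim: eventually_mono)
qed

text \<open>Mirror image with the cocycle \<open>F\<close>: if the lower limit \<open>c\<close> and
  some \<open>r\<close> satisfied \<open>c < r < m z\<close>, then
  \<open>F (n z) \<le> T (n z) 0\<close> would almost surely be below \<open>n r\<close> for some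
  \<open>n\<close>, and by additivity of \<open>F\<close> the maximal inequality would bound the
  mean of \<open>F z\<close> by \<open>r\<close>.\<close>

lemma m_le_liminf: "AE \<omega> in M. m z \<le> liminf (\<lambda>n. ereal (T (int n *s z) 0 \<omega> / n))"
proof -
  let ?X = "\<lambda>\<omega>. liminf (\<lambda>n. ereal (T (int n *s z) 0 \<omega> / n))"
  have meas: "?X \<in> borel_measurable M" by measurable
  have inv: "?X (V y \<omega>) = ?X \<omega>" if "\<omega> \<in> space M" for y \<omega>
  proof -
    have "?X (V y \<omega>) = liminf (\<lambda>n. ereal (T (int n *s z) 0 (V y \<omega>) / n - T (int n *s z) 0 \<omega> / n)
        + ereal (T (int n *s z) 0 \<omega> / n))"
      by simp
    also have "\<dots> = 0 + ?X \<omega>"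
      by (rule ereal_liminf_lim_add[OF rescaled_passage_time_shift[OF that]]) simp
    finally show ?thesis by simp
  qed
  obtain c where c: "AE \<omega> in M. ?X \<omega> = c"
    using invariant_imp_AE_const[of ?X, OF meas inv] by blast
  obtain F :: "int ^ 'd \<Rightarrow> 'w \<Rightarrow> real"
  where F: "\<And>y. F y \<in> borel_measurable M"
    "\<And>y w \<omega>. \<omega> \<in> space M \<Longrightarrow> F (y + w) \<omega> = F y (V w \<omega>) + F w \<omega>"
    "\<And>x \<alpha> \<omega>. \<omega> \<in> space M \<Longrightarrow> \<alpha> \<in> steps \<Longrightarrow> F x \<omega> - F (x + \<alpha>) \<omega> \<le> \<tau> x \<alpha> \<omega>"
    "m z \<le> expectation (F z)"
    by (rule busemann_exists[of z]) (rule that; assumption)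
  have F_int: "integrable M (F z)" by (rule cocycle_integrable; fact F)
  have F0: "F 0 \<omega> = 0" if "\<omega> \<in> space M" for \<omega>
    using F(2)[OF that, of 0 0] that by simp
  have "m z \<le> c"
  proof (rule ccontr)
    assume "\<not> m z \<le> c"
    then obtain r where r: "r < m z" "c < ereal r"
      using ereal_dense2[of c "ereal (m z)"] by (auto simp: not_le)
    have "expectation (\<lambda>\<omega>. r - F z \<omega>) \<ge> 0"
    proof (rule maximal_ergodic[where U = "V z" and s = "\<lambda>n \<omega>. real n * r - F (int n *s z) \<omega>"])
      fix n \<omega> assume \<omega>: "\<omega> \<in> space M"
      have eq: "int (Suc n) *s z = int n *s z + z" by (simp add: vec_eq_iff algebra_simps)
      show "real (Suc n) * r - F (int (Suc n) *s z) \<omega>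
          \<le> r - F z \<omega> + (real n * r - F (int n *s z) (V z \<omega>))"
        unfolding eq F(2)[OF \<omega>] by (simp add: distrib_right)
    next
      show "AE \<omega> in M. \<exists>n. real n * r - F (int n *s z) \<omega> > 0"
        using c AE_space
      proof eventually_elim
        case (elim \<omega>)
        show ?case
        proof (rule ccontr)
          assume neg: "\<nexists>n. real n * r - F (int n *s z) \<omega> > 0"
          have "ereal r \<le> ?X \<omega>"
          proof (rule Liminf_bounded)
            show "\<forall>\<^sub>F n in sequentially. ereal r \<le> ereal (T (int n *s z) 0 \<omega> / n)"
              using eventually_gt_at_top[of 0]
            proof eventually_elim
              case (elim n)
              have "real n * r \<le> F (int n *s z) \<omega> - F 0 \<omega>"
                using neg F0[OF \<open>\<omega> \<in> space M\<close>] by (simp add: not_less)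
              also have "\<dots> \<le> T (int n *s z) 0 \<omega>"
                by (rule passage_time_ge_potential[of "\<lambda>x. F x \<omega>"]) (rule F(3)[OF \<open>\<omega> \<in> space M\<close>])
              finally show ?case using elim by (simp add: field_simps)
            qed
          qed
          then show False using elim r(2) by simp
        qed
      qed
    qed (use F0 F_int in \<open>auto simp: measurable_V measure_preserving\<close>)
    then show False using r(1) F(4) F_int by (simp add: prob_space)
  qed
  then show ?thesis using c by (auto elim: eventually_mono)
qed

lemma K_attains_m:
  obtains q where "q \<in> K" "q \<bullet> real_vec z = m z"
proof -
  obtain F :: "int ^ 'd \<Rightarrow> 'w \<Rightarrow> real"
  where F: "\<And>y. F y \<in> borel_measurable M"
    "\<And>y w \<omega>. \<omega> \<in> space M \<Longrightarrow> F (y + w) \<omega> = F y (V w \<omega>) + F w \<omega>"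
    "\<And>x \<alpha> \<omega>. \<omega> \<in> space M \<Longrightarrow> \<alpha> \<in> steps \<Longrightarrow> F x \<omega> - F (x + \<alpha>) \<omega> \<le> \<tau> x \<alpha> \<omega>"
    "m z \<le> expectation (F z)"
    by (rule busemann_exists[of z]) (rule that; assumption)
  have cocycle_mean: "\<exists>q\<in>K. \<forall>x. expectation (F x) = q \<bullet> real_vec x"
    by (rule cocycle_mean_in_K; fact F)
  obtain q where q: "q \<in> K" "expectation (F z) = q \<bullet> real_vec z"
    using cocycle_mean by blast
  then show ?thesis using that[OF q(1)] K_le_m[OF q(1), of z] F(4) by simp
qed

end

lemma (in prob_space) time_constant_eqI:
  assumes "AE \<omega> in M. (\<lambda>n. passage_time \<tau> (nearest_lattice_point (real n *\<^sub>R x)) 0 \<omega> / real n) \<longlonglongrightarrow> c"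
  shows "time_constant M \<tau> x = c"
  unfolding time_constant_def
proof (rule the_equality, rule assms)
  fix c' assume "AE \<omega> in M.
    (\<lambda>n. passage_time \<tau> (nearest_lattice_point (real n *\<^sub>R x)) 0 \<omega> / real n) \<longlonglongrightarrow> c'"
  then have "AE \<omega> in M. c' = c"
    using assms by eventually_elim (rule LIMSEQ_unique)
  then show "c' = c" by simp
qed

section \<open>The time constant in all real directions as the support function of
  \<open>K\<close>\<close>

context bounded_percolation
begin

definition s :: "real ^ 'd \<Rightarrow> real"
  where "s x = (SUP p\<in>K. p \<bullet> x)"

text \<open>A Lipschitz constant for the Euclidean norm, shared by passage times and the support
  function. The dimension enters when \<open>l1\<close> is compared with that norm.\<close>

definition L :: real
  where "L = b * CARD('d)"

lemma L_pos: "0 < L"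
  using b_pos by (simp add: L_def)

lemma T_le_norm: "\<omega> \<in> space M \<Longrightarrow> \<bar>T x z \<omega> - T y z \<omega>\<bar> \<le> L * norm (real_vec x - real_vec y)"
  using order_trans[OF T_lipschitz[of \<omega> x z y] mult_left_mono[OF l1_le_norm[of "x - y"], of b]] b_pos
  by (simp add: L_def real_vec_diff mult.assoc)

lemma K_bounded:
  assumes "p \<in> K"
  shows "norm p \<le> L"
proof -
  have "\<bar>p $ i\<bar> \<le> b" for i
  proof -
    have l1: "l1 (axis i 1 :: int ^ 'd) = 1"
      by (simp add: l1_def axis_def if_distrib cong: if_cong)
    have "p \<bullet> axis i 1 \<le> b" "p \<bullet> - axis i 1 \<le> b"
      using order_trans[OF K_le_t[OF assms] t_le_l1, of "axis i 1"]
        order_trans[OF K_le_t[OF assms] t_le_l1, of "- axis i 1"] l1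
      by (simp_all add: real_vec_minus real_vec_axis)
    then show ?thesis by (simp add: inner_axis)
  qed
  then have "(\<Sum>i\<in>UNIV. \<bar>p $ i\<bar>) \<le> (\<Sum>i\<in>(UNIV :: 'd set). b)"
    by (intro sum_mono)
  then show ?thesis using norm_le_l1_cart[of p] by (simp add: L_def mult.commute)
qed

text \<open>The zero test function already works, since \<open>p \<bullet> \<alpha>\<close> is at
  most \<open>a\<close> in absolute value. Thus \<open>K\<close> is a neighborhood of 0, which makes
  its support function positive away from 0 and its unit level set bounded.\<close>

lemma K_ball:
  assumes "norm p \<le> a"
  shows "p \<in> K"
proof -
  have "AE \<omega> in M. \<forall>x. \<forall>\<alpha>\<in>steps. - discrete_deriv \<alpha> (\<lambda>_ _. 0) x \<omega> - p \<bullet> real_vec \<alpha> \<le> \<tau> x \<alpha> \<omega>"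
  proof (intro AE_I2 allI ballI)
    fix \<omega> x \<alpha> assume *: "\<omega> \<in> space M" "\<alpha> \<in> (steps :: (int ^ 'd) set)"
    have "\<bar>p \<bullet> real_vec \<alpha>\<bar> \<le> norm p * norm (real_vec \<alpha>)"
      by (rule Cauchy_Schwarz_ineq2)
    then show "- discrete_deriv \<alpha> (\<lambda>_ _. 0) x \<omega> - p \<bullet> real_vec \<alpha> \<le> \<tau> x \<alpha> \<omega>"
      using weight_bounds[OF *(2,1), of x] assms norm_real_vec_steps[OF *(2)]
      by (auto simp: discrete_deriv_def)
  qed
  then show ?thesis using zero_test_function unfolding K_def by blast
qed

lemma K_nonempty: "K \<noteq> {}"
  using K_ball[of 0] a_pos by auto

lemma bdd_above_K: "bdd_above ((\<lambda>p. p \<bullet> x) ` K)"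
proof (rule bdd_aboveI2)
  fix p assume "p \<in> K"
  then show "p \<bullet> x \<le> L * norm x"
    using norm_cauchy_schwarz[of p x] mult_right_mono[OF K_bounded, of p "norm x"] by simp
qed

lemma K_le_s: "p \<in> K \<Longrightarrow> p \<bullet> x \<le> s x"
  unfolding s_def by (rule cSUP_upper[OF _ bdd_above_K])

lemma s_least: "(\<And>p. p \<in> K \<Longrightarrow> p \<bullet> x \<le> c) \<Longrightarrow> s x \<le> c"
  unfolding s_def by (rule cSUP_least[OF K_nonempty])

lemma s_real_vec: "s (real_vec z) = m z"
proof (rule antisym)
  show "s (real_vec z) \<le> m z" by (rule s_least) (rule K_le_m)
  obtain q where "q \<in> K" "q \<bullet> real_vec z = m z" by (rule K_attains_m)
  then show "m z \<le> s (real_vec z)" using K_le_s by metis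
qed

lemma s_scale_le:
  assumes "0 < r"
  shows "s (r *\<^sub>R x) \<le> r * s x"
  by (rule s_least) (use K_le_s mult_left_mono[of _ _ r] assms in auto)

lemma s_scale:
  assumes r: "0 < r"
  shows "s (r *\<^sub>R x) = r * s x"
proof (rule antisym[OF s_scale_le[OF r]])
  have "s x \<le> inverse r * s (r *\<^sub>R x)"
    using s_scale_le[of "inverse r" "r *\<^sub>R x"] r by simp
  then show "r * s x \<le> s (r *\<^sub>R x)" using r by (simp add: field_simps)
qed

lemma s_lipschitz: "s x \<le> s y + L * norm (x - y)"
proof (rule s_least)
  fix p assume p: "p \<in> K"
  have "p \<bullet> x = p \<bullet> y + p \<bullet> (x - y)" by (simp add: inner_diff_right)
  also have "p \<bullet> (x - y) \<le> L * norm (x - y)"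
    using norm_cauchy_schwarz[of p "x - y"] mult_right_mono[OF K_bounded[OF p], of "norm (x - y)"]
    by simp
  also have "p \<bullet> y \<le> s y" by (rule K_le_s[OF p])
  finally show "p \<bullet> x \<le> s y + L * norm (x - y)" by simp
qed

lemma s_ge_norm: "a * norm x \<le> s x"
proof (cases "x = 0")
  case True
  obtain p where "p \<in> K" using K_nonempty by blast
  then show ?thesis using K_le_s[of p 0] True by simp
next
  case False
  have "(a / norm x) *\<^sub>R x \<in> K"
    using False a_pos by (intro K_ball) simp
  from K_le_s[OF this, of x] show ?thesis
    using False by (simp add: dot_square_norm power2_eq_square)
qed

lemma s_pos: "x \<noteq> 0 \<Longrightarrow> 0 < s x"
  using s_ge_norm[of x] a_pos by (smt (verit) mult_pos_pos zero_less_norm_iff)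

lemma m_nonneg: "0 \<le> m z"
  using s_ge_norm[of "real_vec z"] a_pos s_real_vec[of z]
  by (metis mult_nonneg_nonneg less_imp_le norm_ge_zero order_trans)

text \<open>Three errors separate the lattice point near \<open>n x\<close> from
  \<open>(n div k) v\<close>: the rounding of \<open>n x\<close>, the remainder
  \<open>n mod k\<close> times \<open>x\<close>, and \<open>n div k\<close> copies of
  \<open>k x - v\<close>. The first two stay bounded in \<open>n\<close>; the third grows at the
  small rate \<delta>.\<close>

lemma compare_direction:
  assumes \<omega>: "\<omega> \<in> space M" and k: "0 < k"
    and v: "norm (real k *\<^sub>R x - real_vec v) \<le> real k * \<delta>"
  shows "\<bar>T (nearest_lattice_point (real n *\<^sub>R x)) 0 \<omega> - T (int (n div k) *s v) 0 \<omega>\<bar>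
    \<le> L * (CARD('d) + real k * norm x) + L * \<delta> * n"
proof -
  let ?q = "n div k"
  have \<delta>: "0 \<le> \<delta>"
    using k order_trans[OF norm_ge_zero v] by (simp add: zero_le_mult_iff)
  have "real ?q * real k + real (n mod k) = real n"
    by (metis div_mult_mod_eq of_nat_add of_nat_mult)
  then have n: "real n - real ?q * real k = real (n mod k)" by simp
  have "real_vec (nearest_lattice_point (real n *\<^sub>R x)) - real_vec (int ?q *s v)
      = (real_vec (nearest_lattice_point (real n *\<^sub>R x)) - real n *\<^sub>R x)
        + (real n - real ?q * real k) *\<^sub>R x + real ?q *\<^sub>R (real k *\<^sub>R x - real_vec v)"
    by (simp add: real_vec_scale algebra_simps)
  also have "norm \<dots> \<le> norm (real_vec (nearest_lattice_point (real n *\<^sub>R x)) - real n *\<^sub>R x)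
      + norm ((real n - real ?q * real k) *\<^sub>R x) + norm (real ?q *\<^sub>R (real k *\<^sub>R x - real_vec v))"
    by (intro order_trans[OF norm_triangle_ineq] add_right_mono norm_triangle_ineq)
  also have "\<dots> \<le> CARD('d) + real k * norm x + real n * \<delta>"
  proof (intro add_mono norm_nearest_lattice_point)
    show "norm ((real n - real ?q * real k) *\<^sub>R x) \<le> real k * norm x"
      unfolding n using k by (simp add: mult_right_mono)
    have "norm (real ?q *\<^sub>R (real k *\<^sub>R x - real_vec v)) \<le> real ?q * (real k * \<delta>)"
      using v by (simp add: mult_left_mono)
    also have "\<dots> \<le> real n * \<delta>"
      using n \<delta> by (simp add: mult.assoc[symmetric] mult_right_mono)
    finally show "norm (real ?q *\<^sub>R (real k *\<^sub>R x - real_vec v)) \<le> real n * \<delta>" .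
  qed
  finally have "L * norm (real_vec (nearest_lattice_point (real n *\<^sub>R x)) - real_vec (int ?q *s v))
      \<le> L * (CARD('d) + real k * norm x + real n * \<delta>)"
    using L_pos by (simp add: mult_left_mono)
  then show ?thesis
    using T_le_norm[OF \<omega>, of "nearest_lattice_point (real n *\<^sub>R x)" 0 "int ?q *s v"]
    by (simp add: algebra_simps)
qed

lemma passage_time_upper:
  assumes \<omega>: "\<omega> \<in> space M" and k: "0 < k"
    and v: "norm (real k *\<^sub>R x - real_vec v) \<le> real k * \<delta>"
    and lim: "limsup (\<lambda>n. ereal (T (int n *s v) 0 \<omega> / n)) \<le> t v"
    and c: "t v / k + L * \<delta> < c"
  shows "\<forall>\<^sub>F n in sequentially. T (nearest_lattice_point (real n *\<^sub>R x)) 0 \<omega> \<le> c * real n"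
proof -
  \<comment> \<open>One half of the slack in \<open>c\<close> is spent on passing from the upper
    limit to finite \<open>n\<close>, the other half on the part of the error in
    \<open>compare_direction\<close> that does not grow with \<open>n\<close>.\<close>
  define \<eta> where "\<eta> = (c - (t v / k + L * \<delta>)) / 2"
  have \<eta>: "0 < \<eta>" using c by (simp add: \<eta>_def)
  have c_eq: "c = (t v / k + \<eta>) + \<eta> + L * \<delta>" by (simp add: \<eta>_def field_simps)
  have "limsup (\<lambda>n. ereal (T (int n *s v) 0 \<omega> / n)) < ereal (t v + k * \<eta>)"
    using k \<eta> by (intro le_less_trans[OF lim]) simp
  then have "\<forall>\<^sub>F n in sequentially. ereal (T (int n *s v) 0 \<omega> / n) < ereal (t v + k * \<eta>)"
    by (rule Limsup_lessD)
  then have "\<forall>\<^sub>F n in sequentially. T (int n *s v) 0 \<omega> \<le> (t v + k * \<eta>) * n"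
    using eventually_gt_at_top[of 0]
  proof eventually_elim
    case (elim n)
    then show ?case by (simp add: field_simps)
  qed
  from eventually_div[OF this k] eventually_le_linear[OF \<eta>, of "L * (CARD('d) + real k * norm x)"]
  show ?thesis
  proof eventually_elim
    case (elim n)
    have "real (n div k) \<le> real n / real k"
      by (rule of_nat_div_le_of_nat)
    moreover have "0 \<le> t v + k * \<eta>" using t_nonneg[of v] \<eta> by simp
    ultimately have "(t v + k * \<eta>) * real (n div k) \<le> (t v + k * \<eta>) * (real n / real k)"
      by (rule mult_left_mono)
    also have "\<dots> = (t v / k + \<eta>) * real n" using k by (simp add: field_simps)
    finally have "T (int (n div k) *s v) 0 \<omega> \<le> (t v / k + \<eta>) * real n"
      using elim(1) by linarith
    then show ?case
      using compare_direction[OF \<omega> k v, of n] elim(2) unfolding c_eq distrib_right by linarith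
  qed
qed

lemma passage_time_lower:
  assumes \<omega>: "\<omega> \<in> space M" and k: "0 < k"
    and v: "norm (real k *\<^sub>R x - real_vec v) \<le> real k * \<delta>"
    and lim: "m v \<le> liminf (\<lambda>n. ereal (T (int n *s v) 0 \<omega> / n))"
    and c: "c < m v / k - L * \<delta>"
  shows "\<forall>\<^sub>F n in sequentially. c * real n \<le> T (nearest_lattice_point (real n *\<^sub>R x)) 0 \<omega>"
proof -
  define \<eta> where "\<eta> = (m v / k - L * \<delta> - c) / 2"
  have \<eta>: "0 < \<eta>" using c by (simp add: \<eta>_def)
  have c_eq: "c = m v / k - \<eta> - \<eta> - L * \<delta>" by (simp add: \<eta>_def field_simps)
  have "ereal (m v - k * \<eta>) < liminf (\<lambda>n. ereal (T (int n *s v) 0 \<omega> / n))"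
    using k \<eta> by (intro less_le_trans[OF _ lim]) simp
  then have "\<forall>\<^sub>F n in sequentially. ereal (m v - k * \<eta>) < ereal (T (int n *s v) 0 \<omega> / n)"
    by (rule less_LiminfD)
  then have "\<forall>\<^sub>F n in sequentially. (m v - k * \<eta>) * n \<le> T (int n *s v) 0 \<omega>"
    using eventually_gt_at_top[of 0]
  proof eventually_elim
    case (elim n)
    then show ?case by (simp add: field_simps)
  qed
  \<comment> \<open>The extra \<open>m v\<close> pays for the floor, because \<open>n div k\<close>
    is at least \<open>n / k - 1\<close>.\<close>
  from eventually_div[OF this k]
    eventually_le_linear[OF \<eta>, of "L * (CARD('d) + real k * norm x) + m v"]
  show ?thesis
  proof eventually_elim
    case (elim n)
    have "real n / real k - 1 \<le> real (n div k)"
    proof -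
      have "real (n div k) * real k + real (n mod k) = real n"
        by (metis div_mult_mod_eq of_nat_add of_nat_mult)
      moreover have "real (n mod k) \<le> real k" using k by simp
      ultimately have "real n \<le> (real (n div k) + 1) * real k" by (simp add: distrib_right)
      then show ?thesis using k by (simp add: field_simps)
    qed
    then have 1: "m v * (real n / real k - 1) \<le> m v * real (n div k)"
      by (intro mult_left_mono m_nonneg)
    have 2: "k * \<eta> * real (n div k) \<le> k * \<eta> * (real n / real k)"
      using \<eta> of_nat_div_le_of_nat[of n k] by (intro mult_left_mono) auto
    have "(m v / k - \<eta>) * real n - m v = m v * (real n / real k - 1) - k * \<eta> * (real n / real k)"
      using k by (simp add: field_simps)
    also have "\<dots> \<le> (m v - k * \<eta>) * real (n div k)"
      using 1 2 by (simp add: left_diff_distrib)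
    finally have "(m v / k - \<eta>) * real n - m v \<le> T (int (n div k) *s v) 0 \<omega>"
      using elim(1) by linarith
    then show ?case
      using compare_direction[OF \<omega> k v, of n] elim(2) unfolding c_eq left_diff_distrib by linarith
  qed
qed

text \<open>The almost sure event involves only the countably many lattice directions, so one null
  set serves every real \<open>x\<close>; the rest is a deterministic approximation of
  \<open>x\<close> by \<open>z / k\<close>.\<close>

lemma passage_time_limit:
  "AE \<omega> in M. \<forall>x. (\<lambda>n. T (nearest_lattice_point (real n *\<^sub>R x)) 0 \<omega> / real n) \<longlonglongrightarrow> s x"
proof -
  have "AE \<omega> in M. \<forall>z. limsup (\<lambda>n. ereal (T (int n *s z) 0 \<omega> / n)) \<le> t z \<and>
      m z \<le> liminf (\<lambda>n. ereal (T (int n *s z) 0 \<omega> / n))"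
    unfolding AE_all_countable using limsup_le_t m_le_liminf by (auto elim: eventually_elim2)
  then show ?thesis
    using AE_space
  proof eventually_elim
    case (elim \<omega>)
    let ?d = "real CARD('d)"
    have upper: "\<forall>\<^sub>F n in sequentially. T (nearest_lattice_point (real n *\<^sub>R x)) 0 \<omega> \<le> (s x + e) * real n"
      and lower: "\<forall>\<^sub>F n in sequentially. (s x - e) * real n \<le> T (nearest_lattice_point (real n *\<^sub>R x)) 0 \<omega>"
      if e: "0 < e" for x e
    proof -
      \<comment> \<open>The total error is at most \<open>(2 L d + 1) / k\<close>: one
        \<open>L d\<close> for rounding \<open>k x\<close> to \<open>z\<close> inside
        \<open>s\<close>, one for the same rounding inside \<open>T\<close>, and 1 for the choice of
        \<open>j\<close> in the upper bound.\<close>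
      obtain k :: nat where k: "(2 * L * ?d + 1) / e < real k" using reals_Archimedean2 by blast
      have "0 \<le> (2 * L * ?d + 1) / e" using L_pos e by simp
      then have k0: "0 < k" using k by linarith
      have ke: "2 * L * ?d + 1 < real k * e" using k e by (simp add: field_simps)
      define z where "z = nearest_lattice_point (real k *\<^sub>R x)"
      have z: "norm (real k *\<^sub>R x - real_vec z) \<le> ?d"
        unfolding z_def using norm_nearest_lattice_point[of "real k *\<^sub>R x"]
        by (simp add: norm_minus_commute)
      have L_z: "L * norm (real k *\<^sub>R x - real_vec z) \<le> L * ?d"
        using z L_pos by (simp add: mult_left_mono)
      have m1: "m z \<le> real k * s x + L * ?d"
        using s_lipschitz[of "real_vec z" "real k *\<^sub>R x"] s_scale[of "real k" x] k0 L_z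
        by (simp add: s_real_vec norm_minus_commute)
      have m2: "real k * s x \<le> m z + L * ?d"
        using s_lipschitz[of "real k *\<^sub>R x" "real_vec z"] s_scale[of "real k" x] k0 L_z
        by (simp add: s_real_vec)
      \<comment> \<open>\<open>limsup_le_t\<close> bounds by \<open>t\<close> rather than by
        \<open>m\<close>, so it is applied to a multiple \<open>j z\<close> for which
        \<open>t (j z) / j\<close> is within 1 of \<open>m z\<close>. After rescaling by
        \<open>k\<close> this costs only \<open>1 / k\<close>.\<close>
      have "(INF j\<in>{0<..}. t (int j *s z) / real j) < m z + 1"
        by (simp add: m_def[symmetric])
      then obtain j :: nat where j: "0 < j" "t (int j *s z) / real j < m z + 1"
        by (subst (asm) cINF_less_iff) (auto intro!: bdd_belowI2[where m = 0] divide_nonneg_nonneg t_nonneg)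
      show "\<forall>\<^sub>F n in sequentially. T (nearest_lattice_point (real n *\<^sub>R x)) 0 \<omega> \<le> (s x + e) * real n"
      proof (rule passage_time_upper[of \<omega> "k * j" x "int j *s z" "?d / k"])
        have "real (k * j) *\<^sub>R x - real_vec (int j *s z) = real j *\<^sub>R (real k *\<^sub>R x - real_vec z)"
          by (simp add: real_vec_scale algebra_simps)
        then show "norm (real (k * j) *\<^sub>R x - real_vec (int j *s z)) \<le> real (k * j) * (?d / k)"
          using z k0 by (simp add: mult_left_mono)
        have "t (int j *s z) / real (k * j) \<le> (m z + 1) / k"
          using j k0 by (simp add: field_simps)
        also have "\<dots> \<le> (real k * s x + L * ?d + 1) / k"
          using m1 k0 by (intro divide_right_mono) auto
        also have "\<dots> = s x + (2 * L * ?d + 1) / k - L * (?d / k)"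
          using k0 by (simp add: field_simps)
        finally have "t (int j *s z) / real (k * j) + L * (?d / k) \<le> s x + (2 * L * ?d + 1) / k"
          by linarith
        also have "\<dots> < s x + e" using ke k0 by (simp add: field_simps)
        finally show "t (int j *s z) / real (k * j) + L * (?d / k) < s x + e" .
        show "limsup (\<lambda>n. ereal (T (int n *s (int j *s z)) 0 \<omega> / n)) \<le> t (int j *s z)"
          using elim(1) by blast
      qed (use elim(2) k0 j(1) in auto)
      show "\<forall>\<^sub>F n in sequentially. (s x - e) * real n \<le> T (nearest_lattice_point (real n *\<^sub>R x)) 0 \<omega>"
      proof (rule passage_time_lower[of \<omega> k x z "?d / k"])
        show "norm (real k *\<^sub>R x - real_vec z) \<le> real k * (?d / k)" using z k0 by simp
        have "s x - e < s x - (2 * L * ?d) / k" using ke k0 by (simp add: field_simps)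
        also have "\<dots> = (real k * s x - L * ?d) / k - L * (?d / k)"
          using k0 by (simp add: field_simps)
        also have "\<dots> \<le> m z / k - L * (?d / k)"
          using m2 k0 by (intro diff_right_mono divide_right_mono) auto
        finally show "s x - e < m z / k - L * (?d / k)" .
      qed (use elim k0 in auto)
    qed
    show ?case
    proof (intro allI tendstoI)
      fix x e assume "0 < (e :: real)"
      then have "0 < e / 2" by simp
      from upper[OF this, of x] lower[OF this, of x] eventually_gt_at_top[of 0]
      show "\<forall>\<^sub>F n in sequentially.
          dist (T (nearest_lattice_point (real n *\<^sub>R x)) 0 \<omega> / real n) (s x) < e"
      proof eventually_elim
        case (elim n)
        let ?T = "T (nearest_lattice_point (real n *\<^sub>R x)) 0 \<omega> / real n"
        have "?T \<le> s x + e / 2" "s x - e / 2 \<le> ?T"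
          using elim by (simp_all add: pos_divide_le_eq pos_le_divide_eq)
        then show ?case using \<open>0 < e\<close> by (simp add: dist_real_def abs_less_iff)
      qed
    qed
  qed
qed

end

section \<open>Duality\<close>

lemma (in ergodic_action) measurable_SUP_discrete_hamiltonian:
  assumes \<phi>: "\<phi> \<in> test_functions M V"
    and \<tau>: "\<And>x \<alpha>. \<alpha> \<in> steps \<Longrightarrow> \<tau> x \<alpha> \<in> borel_measurable M"
  shows "(\<lambda>\<omega>. SUP x. ereal (discrete_hamiltonian \<tau> \<phi> p x \<omega>)) \<in> borel_measurable M"
proof (rule borel_measurable_SUP)
  fix x
  have "discrete_hamiltonian \<tau> \<phi> p x \<in> borel_measurable M"
    unfolding discrete_hamiltonian_def[abs_def]
  proof (rule borel_measurable_cSUP)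
    fix \<alpha> assume \<alpha>: "\<alpha> \<in> (steps :: (int ^ 'd) set)"
    note [measurable] = test_function_deriv_measurable[OF \<phi> \<alpha>] \<tau>[OF \<alpha>]
    show "(\<lambda>\<omega>. (- discrete_deriv \<alpha> \<phi> x \<omega> - p \<bullet> real_vec \<alpha>) / \<tau> x \<alpha> \<omega>) \<in> borel_measurable M"
      by measurable
  qed (auto intro: countable_finite)
  then show "(\<lambda>\<omega>. ereal (discrete_hamiltonian \<tau> \<phi> p x \<omega>)) \<in> borel_measurable M"
    by simp
qed simp

section \<open>The Hamiltonian bound as a gauge of \<open>K\<close>\<close>

context bounded_percolation
begin

text \<open>Clearing the positive denominators leaves inequalities linear in the derivatives and in
  \<open>p\<close>, with \<open>h\<close> as a factor on the weights; rescaling by \<open>h\<close>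
  then leads to \<open>K\<close>.\<close>

lemma esssup_hamiltonian_le_iff:
  assumes \<phi>: "\<phi> \<in> test_functions M V"
  shows "esssup M (\<lambda>\<omega>. SUP x. ereal (discrete_hamiltonian \<tau> \<phi> p x \<omega>)) \<le> ereal h \<longleftrightarrow>
    (AE \<omega> in M. \<forall>x. \<forall>\<alpha>\<in>steps. - discrete_deriv \<alpha> \<phi> x \<omega> - p \<bullet> real_vec \<alpha> \<le> h * \<tau> x \<alpha> \<omega>)"
    (is "?E \<le> _ \<longleftrightarrow> ?R")
proof -
  have *: "(SUP x. ereal (discrete_hamiltonian \<tau> \<phi> p x \<omega>)) \<le> ereal h \<longleftrightarrow>
      (\<forall>x. \<forall>\<alpha>\<in>steps. - discrete_deriv \<alpha> \<phi> x \<omega> - p \<bullet> real_vec \<alpha> \<le> h * \<tau> x \<alpha> \<omega>)"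
    if \<omega>: "\<omega> \<in> space M" for \<omega>
  proof -
    have "0 < \<tau> x \<alpha> \<omega>" if "\<alpha> \<in> steps" for x \<alpha>
      using weight_bounds[OF that \<omega>, of x] a_pos by linarith
    moreover have "discrete_hamiltonian \<tau> \<phi> p x \<omega> \<le> h \<longleftrightarrow>
        (\<forall>\<alpha>\<in>steps. (- discrete_deriv \<alpha> \<phi> x \<omega> - p \<bullet> real_vec \<alpha>) / \<tau> x \<alpha> \<omega> \<le> h)" for x
      unfolding discrete_hamiltonian_def by (rule cSUP_le_iff) auto
    ultimately show ?thesis
      by (simp add: SUP_le_iff pos_divide_le_eq)
  qed
  show ?thesis
  proof
    assume "?E \<le> ereal h"
    then have "AE \<omega> in M. (SUP x. ereal (discrete_hamiltonian \<tau> \<phi> p x \<omega>)) \<le> ereal h"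
      using esssup_AE[where M = M and f = "\<lambda>\<omega>. SUP x. ereal (discrete_hamiltonian \<tau> \<phi> p x \<omega>)"]
      by (auto elim: eventually_mono intro: order_trans)
    then show ?R using AE_space by eventually_elim (simp add: *)
  next
    assume ?R
    then have "AE \<omega> in M. (SUP x. ereal (discrete_hamiltonian \<tau> \<phi> p x \<omega>)) \<le> ereal h"
      using AE_space by eventually_elim (simp add: *)
    then show "?E \<le> ereal h"
      by (intro esssup_I measurable_SUP_discrete_hamiltonian[OF \<phi>] measurable_weight)
  qed
qed

text \<open>A strictly larger \<open>h'\<close> provides a positive divisor even when
  \<open>h\<close> is 0. Since the weights are nonnegative, enlarging \<open>h\<close> only weakens
  the inequalities.\<close>

lemma esssup_hamiltonian_le_imp_K:
  assumes \<phi>: "\<phi> \<in> test_functions M V"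
    and le: "esssup M (\<lambda>\<omega>. SUP x. ereal (discrete_hamiltonian \<tau> \<phi> p x \<omega>)) \<le> ereal h"
  shows "0 \<le> h" and "h < h' \<Longrightarrow> p /\<^sub>R h' \<in> K"
proof -
  have AE: "AE \<omega> in M. \<forall>x. \<forall>\<alpha>\<in>steps. - discrete_deriv \<alpha> \<phi> x \<omega> - p \<bullet> real_vec \<alpha> \<le> h * \<tau> x \<alpha> \<omega>"
    using le esssup_hamiltonian_le_iff[OF \<phi>] by blast
  let ?\<alpha> = "axis undefined 1 :: int ^ 'd"
  \<comment> \<open>The increments along an edge and back along the same edge cancel.\<close>
  have "AE \<omega> in M. 0 \<le> h"
    using AE AE_space
  proof eventually_elim
    case (elim \<omega>)
    have "- discrete_deriv ?\<alpha> \<phi> 0 \<omega> - p \<bullet> real_vec ?\<alpha> \<le> h * \<tau> 0 ?\<alpha> \<omega>"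
      "- discrete_deriv (- ?\<alpha>) \<phi> ?\<alpha> \<omega> - p \<bullet> real_vec (- ?\<alpha>) \<le> h * \<tau> ?\<alpha> (- ?\<alpha>) \<omega>"
      using elim(1) by auto
    then have "0 \<le> h * (\<tau> 0 ?\<alpha> \<omega> + \<tau> ?\<alpha> (- ?\<alpha>) \<omega>)"
      by (simp add: discrete_deriv_def real_vec_minus distrib_left)
    moreover have "0 < \<tau> 0 ?\<alpha> \<omega> + \<tau> ?\<alpha> (- ?\<alpha>) \<omega>"
      using weight_bounds[OF _ elim(2), of ?\<alpha> 0] weight_bounds[OF _ elim(2), of "- ?\<alpha>" ?\<alpha>] a_pos by simp
    ultimately show ?case by (simp add: zero_le_mult_iff)
  qed
  then show h: "0 \<le> h" by simp
  assume h': "h < h'"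
  have "(\<lambda>x \<omega>. inverse h' * \<phi> x \<omega>) \<in> test_functions M V"
    by (rule test_function_scale[OF \<phi>])
  moreover have "AE \<omega> in M. \<forall>x. \<forall>\<alpha>\<in>steps.
      - discrete_deriv \<alpha> (\<lambda>x \<omega>. inverse h' * \<phi> x \<omega>) x \<omega> - (p /\<^sub>R h') \<bullet> real_vec \<alpha> \<le> \<tau> x \<alpha> \<omega>"
    using AE AE_space
  proof (eventually_elim, intro allI ballI)
    fix \<omega> x \<alpha> assume \<omega>: "\<omega> \<in> space M" and \<alpha>: "\<alpha> \<in> (steps :: (int ^ 'd) set)"
      and le: "\<forall>x. \<forall>\<alpha>\<in>steps. - discrete_deriv \<alpha> \<phi> x \<omega> - p \<bullet> real_vec \<alpha> \<le> h * \<tau> x \<alpha> \<omega>"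
    have "- discrete_deriv \<alpha> \<phi> x \<omega> - p \<bullet> real_vec \<alpha> \<le> h * \<tau> x \<alpha> \<omega>"
      using le \<alpha> by blast
    also have "\<dots> \<le> h' * \<tau> x \<alpha> \<omega>"
      by (rule mult_right_mono[OF less_imp_le[OF h'] weight_nonneg[OF \<alpha> \<omega>]])
    finally have "- discrete_deriv \<alpha> \<phi> x \<omega> - p \<bullet> real_vec \<alpha> \<le> h' * \<tau> x \<alpha> \<omega>" .
    then have "inverse h' * (- discrete_deriv \<alpha> \<phi> x \<omega> - p \<bullet> real_vec \<alpha>) \<le> inverse h' * (h' * \<tau> x \<alpha> \<omega>)"
      using h h' by (intro mult_left_mono) auto
    then show "- discrete_deriv \<alpha> (\<lambda>x \<omega>. inverse h' * \<phi> x \<omega>) x \<omega> - (p /\<^sub>R h') \<bullet> real_vec \<alpha> \<le> \<tau> x \<alpha> \<omega>"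
      using h h' by (simp add: discrete_deriv_def right_diff_distrib mult.assoc[symmetric])
  qed
  ultimately show "p /\<^sub>R h' \<in> K" unfolding K_def by blast
qed

lemma K_imp_esssup_hamiltonian_le:
  assumes h: "0 < h" and K: "p /\<^sub>R h \<in> K"
  obtains \<phi> where "\<phi> \<in> test_functions M V"
    "esssup M (\<lambda>\<omega>. SUP x. ereal (discrete_hamiltonian \<tau> \<phi> p x \<omega>)) \<le> ereal h"
proof -
  obtain \<phi> where \<phi>: "\<phi> \<in> test_functions M V"
    and AE: "AE \<omega> in M. \<forall>x. \<forall>\<alpha>\<in>steps. - discrete_deriv \<alpha> \<phi> x \<omega> - (p /\<^sub>R h) \<bullet> real_vec \<alpha> \<le> \<tau> x \<alpha> \<omega>"
    using K by (auto simp: K_def)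
  let ?\<psi> = "\<lambda>x \<omega>. h * \<phi> x \<omega>"
  have \<psi>: "?\<psi> \<in> test_functions M V" by (rule test_function_scale[OF \<phi>])
  have "AE \<omega> in M. \<forall>x. \<forall>\<alpha>\<in>steps. - discrete_deriv \<alpha> ?\<psi> x \<omega> - p \<bullet> real_vec \<alpha> \<le> h * \<tau> x \<alpha> \<omega>"
    using AE
  proof (eventually_elim, intro allI ballI)
    fix \<omega> x \<alpha> assume \<alpha>: "\<alpha> \<in> (steps :: (int ^ 'd) set)"
      and le: "\<forall>x. \<forall>\<alpha>\<in>steps. - discrete_deriv \<alpha> \<phi> x \<omega> - (p /\<^sub>R h) \<bullet> real_vec \<alpha> \<le> \<tau> x \<alpha> \<omega>"
    have "h * (- discrete_deriv \<alpha> \<phi> x \<omega> - (p /\<^sub>R h) \<bullet> real_vec \<alpha>) \<le> h * \<tau> x \<alpha> \<omega>"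
      using le \<alpha> h by (intro mult_left_mono) auto
    then show "- discrete_deriv \<alpha> ?\<psi> x \<omega> - p \<bullet> real_vec \<alpha> \<le> h * \<tau> x \<alpha> \<omega>"
      using h by (simp add: discrete_deriv_def right_diff_distrib mult.assoc[symmetric])
  qed
  then show ?thesis using that[OF \<psi>] esssup_hamiltonian_le_iff[OF \<psi>] by blast
qed

lemma convex_K: "convex K"
proof (rule convexI)
  fix p q :: "real ^ 'd" and u v :: real
  assume p: "p \<in> K" and q: "q \<in> K" and uv: "0 \<le> u" "0 \<le> v" "u + v = 1"
  obtain \<phi> where \<phi>: "\<phi> \<in> test_functions M V"
    and \<phi>_le: "AE \<omega> in M. \<forall>x. \<forall>\<alpha>\<in>steps. - discrete_deriv \<alpha> \<phi> x \<omega> - p \<bullet> real_vec \<alpha> \<le> \<tau> x \<alpha> \<omega>"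
    using p by (auto simp: K_def)
  obtain \<psi> where \<psi>: "\<psi> \<in> test_functions M V"
    and \<psi>_le: "AE \<omega> in M. \<forall>x. \<forall>\<alpha>\<in>steps. - discrete_deriv \<alpha> \<psi> x \<omega> - q \<bullet> real_vec \<alpha> \<le> \<tau> x \<alpha> \<omega>"
    using q by (auto simp: K_def)
  have "AE \<omega> in M. \<forall>x. \<forall>\<alpha>\<in>steps. - discrete_deriv \<alpha> (\<lambda>x \<omega>. u * \<phi> x \<omega> + v * \<psi> x \<omega>) x \<omega>
      - (u *\<^sub>R p + v *\<^sub>R q) \<bullet> real_vec \<alpha> \<le> \<tau> x \<alpha> \<omega>"
    using \<phi>_le \<psi>_le
  proof (eventually_elim, intro allI ballI)
    fix \<omega> x \<alpha> assume \<alpha>: "\<alpha> \<in> (steps :: (int ^ 'd) set)"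
      and *: "\<forall>x. \<forall>\<alpha>\<in>steps. - discrete_deriv \<alpha> \<phi> x \<omega> - p \<bullet> real_vec \<alpha> \<le> \<tau> x \<alpha> \<omega>"
        "\<forall>x. \<forall>\<alpha>\<in>steps. - discrete_deriv \<alpha> \<psi> x \<omega> - q \<bullet> real_vec \<alpha> \<le> \<tau> x \<alpha> \<omega>"
    have "u * (- discrete_deriv \<alpha> \<phi> x \<omega> - p \<bullet> real_vec \<alpha>)
        + v * (- discrete_deriv \<alpha> \<psi> x \<omega> - q \<bullet> real_vec \<alpha>) \<le> u * \<tau> x \<alpha> \<omega> + v * \<tau> x \<alpha> \<omega>"
      using * \<alpha> uv by (intro add_mono mult_left_mono) auto
    also have "\<dots> = \<tau> x \<alpha> \<omega>" using uv by (simp add: distrib_right[symmetric])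
    finally show "- discrete_deriv \<alpha> (\<lambda>x \<omega>. u * \<phi> x \<omega> + v * \<psi> x \<omega>) x \<omega>
        - (u *\<^sub>R p + v *\<^sub>R q) \<bullet> real_vec \<alpha> \<le> \<tau> x \<alpha> \<omega>"
      unfolding discrete_deriv_linear by (simp add: inner_add_left algebra_simps)
  qed
  then show "u *\<^sub>R p + v *\<^sub>R q \<in> K"
    using test_function_linear[OF \<phi> \<psi>] unfolding K_def by blast
qed

text \<open>A bipolar argument. If \<open>p / h\<close> lies in \<open>K\<close>, then
  \<open>p \<bullet> x \<le> h\<close> on the unit level set of \<open>s\<close>. If it does not, a
  separating hyperplane has a normal \<open>u\<close> with
  \<open>p \<bullet> u / s u \<ge> h\<close>, which is impossible once \<open>h\<close> exceeds the
  supremum.\<close>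

lemma variational_formula:
  "ereal (SUP x\<in>{x. s x = 1}. p \<bullet> x) =
    (INF \<phi>\<in>test_functions M V. esssup M (\<lambda>\<omega>. SUP x. ereal (discrete_hamiltonian \<tau> \<phi> p x \<omega>)))"
    (is "ereal ?H = ?I")
proof (rule antisym)
  have bdd: "bdd_above ((\<lambda>x. p \<bullet> x) ` {x. s x = 1})"
  proof (rule bdd_aboveI2)
    fix x assume "x \<in> {x. s x = 1}"
    then have "norm x \<le> 1 / a" using s_ge_norm[of x] a_pos by (simp add: field_simps)
    then show "p \<bullet> x \<le> norm p * (1 / a)"
      using norm_cauchy_schwarz[of p x] mult_left_mono[of "norm x" "1 / a" "norm p"] by simp
  qed
  \<comment> \<open>Homogeneity turns the supremum over the level set into a bound on
    \<open>p \<bullet> x / s x\<close> for all nonzero \<open>x\<close>.\<close>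
  have unit: "s (x /\<^sub>R s x) = 1" if "x \<noteq> 0" for x
    using s_pos[OF that] by (simp add: s_scale)
  have H_ge: "p \<bullet> x / s x \<le> ?H" if "x \<noteq> 0" for x
    using cSUP_upper[OF _ bdd, of "x /\<^sub>R s x"] unit[OF that] by (simp add: divide_inverse mult.commute)
  show "ereal ?H \<le> ?I"
  proof (rule INF_greatest, rule ccontr)
    fix \<phi> assume \<phi>: "\<phi> \<in> test_functions M V"
    let ?E = "esssup M (\<lambda>\<omega>. SUP x. ereal (discrete_hamiltonian \<tau> \<phi> p x \<omega>))"
    assume "\<not> ereal ?H \<le> ?E"
    then obtain h where h: "?E < ereal h" "h < ?H"
      using ereal_dense2[of ?E "ereal ?H"] by (auto simp: not_le)
    obtain h' where h': "h < h'" "h' < ?H" using dense[OF h(2)] by blast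
    note K = esssup_hamiltonian_le_imp_K[OF \<phi> less_imp_le[OF h(1)]]
    have h'_pos: "0 < h'" using K(1) h'(1) by linarith
    have "?H \<le> h'"
    proof (rule cSUP_least)
      have "axis undefined 1 \<noteq> (0 :: real ^ 'd)" by simp
      from unit[OF this] show "{x. s x = 1} \<noteq> {}" by blast
      fix x assume "x \<in> {x. s x = 1}"
      then show "p \<bullet> x \<le> h'"
        using K_le_s[OF K(2)[OF h'(1)], of x] h'_pos by (simp add: field_simps)
    qed
    then show False using h'(2) by simp
  qed
  have H_nonneg: "0 \<le> ?H"
  proof (cases "p = 0")
    case True
    then show ?thesis using H_ge[of "axis undefined 1"] by simp
  next
    case False
    have "0 \<le> p \<bullet> p / s p" using s_pos[OF False] by simp
    then show ?thesis using H_ge[OF False] by linarith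
  qed
  show "?I \<le> ereal ?H"
  proof (rule ccontr)
    assume "\<not> ?I \<le> ereal ?H"
    then obtain h where h: "?H < h" "ereal h < ?I"
      using ereal_dense2[of "ereal ?H" ?I] by (auto simp: not_le)
    have h_pos: "0 < h" using H_nonneg h(1) by linarith
    have "p /\<^sub>R h \<in> K"
    proof (rule ccontr)
      assume "p /\<^sub>R h \<notin> K"
      \<comment> \<open>Closedness of \<open>K\<close> is not at hand, so the separation is only
        weak; the strict inequality \<open>?H < h\<close> makes up for it.\<close>
      then obtain u c where u: "u \<noteq> 0" and c: "\<And>q. q \<in> K \<Longrightarrow> u \<bullet> q \<le> c" "c \<le> u \<bullet> (p /\<^sub>R h)"
        using separating_hyperplane_sets[OF convex_K convex_singleton[of "p /\<^sub>R h"] K_nonempty]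
        by auto
      have "s u \<le> c" by (rule s_least) (use c(1) in \<open>simp add: inner_commute\<close>)
      then have "s u \<le> (p \<bullet> u) / h" using c(2) by (simp add: inner_commute divide_inverse mult.commute)
      then have "h \<le> p \<bullet> u / s u" using h_pos s_pos[OF u] by (simp add: field_simps)
      then show False using H_ge[OF u] h(1) by linarith
    qed
    then obtain \<phi> where "\<phi> \<in> test_functions M V"
      "esssup M (\<lambda>\<omega>. SUP x. ereal (discrete_hamiltonian \<tau> \<phi> p x \<omega>)) \<le> ereal h"
      by (rule K_imp_esssup_hamiltonian_le[OF h_pos])
    then have "?I \<le> ereal h" by (blast intro: INF_lower2)
    then show False using h(2) by simp
  qed
qed

end

text \<open>For the counting measure, almost every edge means every edge, so splitting the product
  gives bounds for each edge separately, and countability of the edges merges the null sets.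
  \<open>a\<close> and \<open>b\<close> are reals strictly below the essential infimum and strictly
  above the essential supremum.\<close>

lemma (in first_passage_percolation) essential_weight_bounds:
  obtains a b where "0 < a" "AE \<omega> in M. \<forall>x. \<forall>\<alpha>\<in>steps. a \<le> \<tau> x \<alpha> \<omega> \<and> \<tau> x \<alpha> \<omega> \<le> b"
proof -
  let ?C = "count_space (UNIV \<times> steps) :: ((int ^ 'd) \<times> (int ^ 'd)) measure"
  let ?f = "\<lambda>((x, \<alpha>), \<omega>). ereal (\<tau> x \<alpha> \<omega>)"
  interpret C: sigma_finite_measure ?C
    by (rule sigma_finite_measure_count_space_countable) simp
  interpret CM: pair_sigma_finite ?C M ..
  obtain a where a: "0 < a" "ereal a < essinf (?C \<Otimes>\<^sub>M M) ?f"
    using ereal_dense2[OF essinf_pos] by (auto simp: zero_ereal_def)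
  obtain b where b: "esssup (?C \<Otimes>\<^sub>M M) ?f < ereal b"
    using ereal_dense2[OF esssup_finite] by auto
  have "AE p in ?C \<Otimes>\<^sub>M M. ereal a \<le> ?f p \<and> ?f p \<le> ereal b"
    using esssup_AE[where M = "?C \<Otimes>\<^sub>M M" and f = "\<lambda>p. - ?f p"]
      esssup_AE[where M = "?C \<Otimes>\<^sub>M M" and f = ?f]
  proof eventually_elim
    case (elim p)
    have "- esssup (?C \<Otimes>\<^sub>M M) (\<lambda>p. - ?f p) \<le> ?f p"
      using elim(1) by (simp add: ereal_uminus_le_reorder)
    then show ?case
      using elim(2) a(2) b unfolding essinf_def by (auto intro: less_imp_le order_trans)
  qed
  then have "AE q in ?C. AE \<omega> in M. ereal a \<le> ?f (q, \<omega>) \<and> ?f (q, \<omega>) \<le> ereal b"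
    by (rule CM.AE_pair)
  then have "\<forall>q\<in>UNIV \<times> steps. AE \<omega> in M. ereal a \<le> ?f (q, \<omega>) \<and> ?f (q, \<omega>) \<le> ereal b"
    by (simp add: AE_count_space)
  then have "AE \<omega> in M. a \<le> \<tau> x \<alpha> \<omega> \<and> \<tau> x \<alpha> \<omega> \<le> b" if "\<alpha> \<in> steps" for x \<alpha>
    using that by fastforce
  then have "AE \<omega> in M. \<forall>x. \<forall>\<alpha>\<in>steps. a \<le> \<tau> x \<alpha> \<omega> \<and> \<tau> x \<alpha> \<omega> \<le> b"
    by (simp add: AE_all_countable AE_ball_countable countable_finite)
  then show ?thesis by (rule that[OF a(1)])
qed

theorem theorem2p3:
  fixes M :: "'w measure"
    and V :: "int ^ 'd \<Rightarrow> 'w \<Rightarrow> 'w"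
    and \<tau> :: "int ^ 'd \<Rightarrow> int ^ 'd \<Rightarrow> 'w \<Rightarrow> real"
    and p :: "real ^ 'd"
  assumes "first_passage_percolation M V \<tau>"
  shows "ereal (effective_hamiltonian M \<tau> p) =
    (INF \<phi>\<in>test_functions M V.
      esssup M (\<lambda>\<omega>. SUP x. ereal (discrete_hamiltonian \<tau> \<phi> p x \<omega>)))"
proof -
  interpret first_passage_percolation M V \<tau> by fact
  obtain a b where a: "0 < a"
    and bounds: "AE \<omega> in M. \<forall>x. \<forall>\<alpha>\<in>steps. a \<le> \<tau> x \<alpha> \<omega> \<and> \<tau> x \<alpha> \<omega> \<le> b"
    by (rule essential_weight_bounds)
  \<comment> \<open>The bounds are imposed on all edges at once, so that stationarity makes
    \<open>G\<close> invariant under every shift.\<close>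
  define G where "G = {\<omega>\<in>space M. \<forall>x. \<forall>\<alpha>\<in>steps. a \<le> \<tau> x \<alpha> \<omega> \<and> \<tau> x \<alpha> \<omega> \<le> b}"
  have [measurable]: "G \<in> sets M"
    unfolding G_def
  proof (intro sets.sets_Collect_countable_All sets.sets_Collect_finite_All)
    fix x \<alpha> assume "\<alpha> \<in> (steps :: (int ^ 'd) set)"
    note [measurable] = measurable_weight[OF this]
    show "{\<omega>\<in>space M. a \<le> \<tau> x \<alpha> \<omega> \<and> \<tau> x \<alpha> \<omega> \<le> b} \<in> sets M" by measurable
  qed simp
  have AE_G: "AE \<omega> in M. \<omega> \<in> G"
    using bounds AE_space by eventually_elim (simp add: G_def)
  have "a \<le> b"
  proof -
    have "AE \<omega> in M. a \<le> b"
      using bounds by eventually_elim (meson axis_in_steps(1) order_trans)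
    then show ?thesis by simp
  qed
  have G_V: "V y \<omega> \<in> G \<longleftrightarrow> \<omega> \<in> G" if "\<omega> \<in> space M" for y \<omega>
  proof -
    have "(\<forall>x. \<forall>\<alpha>\<in>steps. a \<le> \<tau> x \<alpha> (V y \<omega>) \<and> \<tau> x \<alpha> (V y \<omega>) \<le> b)
        \<longleftrightarrow> (\<forall>x. \<forall>\<alpha>\<in>steps. a \<le> \<tau> (x + y) \<alpha> \<omega> \<and> \<tau> (x + y) \<alpha> \<omega> \<le> b)"
      using stationary that by simp
    also have "\<dots> \<longleftrightarrow> (\<forall>x. \<forall>\<alpha>\<in>steps. a \<le> \<tau> x \<alpha> \<omega> \<and> \<tau> x \<alpha> \<omega> \<le> b)"
      by (metis diff_add_cancel)
    finally show ?thesis using that by (simp add: G_def)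
  qed
  \<comment> \<open>Off \<open>G\<close> every edge receives the constant weight \<open>a\<close>,
    which is positive, within the bounds because \<open>a \<le> b\<close>, and stationary because
    \<open>G\<close> is invariant. Passage times and Hamiltonians change only on a null set.\<close>
  define \<tau>' where "\<tau>' x \<alpha> \<omega> = (if \<omega> \<in> G then \<tau> x \<alpha> \<omega> else a)" for x \<alpha> \<omega>
  have measurable_\<tau>': "\<tau>' x \<alpha> \<in> borel_measurable M" if "\<alpha> \<in> steps" for x \<alpha>
    unfolding \<tau>'_def[abs_def] using measurable_weight[OF that] by measurable
  interpret B: bounded_percolation M V \<tau>' a b
  proof
    show "0 < a" by (rule a)
    fix x y \<alpha> assume \<alpha>: "\<alpha> \<in> (steps :: (int ^ 'd) set)"
    show "\<tau>' x \<alpha> \<in> borel_measurable M" by (rule measurable_\<tau>'[OF \<alpha>])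
    fix \<omega> assume \<omega>: "\<omega> \<in> space M"
    show "a \<le> \<tau>' x \<alpha> \<omega> \<and> \<tau>' x \<alpha> \<omega> \<le> b"
      using \<alpha> \<open>a \<le> b\<close> by (auto simp: \<tau>'_def G_def)
    show "\<tau>' (x + y) \<alpha> \<omega> = \<tau>' x \<alpha> (V y \<omega>)"
      using stationary[OF \<alpha> \<omega>] G_V[OF \<omega>] by (simp add: \<tau>'_def)
  qed
  have "time_constant M \<tau> x = B.s x" for x
  proof (rule time_constant_eqI)
    show "AE \<omega> in M. (\<lambda>n. passage_time \<tau> (nearest_lattice_point (real n *\<^sub>R x)) 0 \<omega> / real n)
        \<longlonglongrightarrow> B.s x"
      using B.passage_time_limit AE_G
    proof eventually_elim
      case (elim \<omega>)
      have "passage_time \<tau> y z \<omega> = passage_time \<tau>' y z \<omega>" for y z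
        using elim(2) by (simp add: passage_time_def path_weight_def \<tau>'_def)
      then show ?case using elim(1) by simp
    qed
  qed
  then have "effective_hamiltonian M \<tau> p = (SUP x\<in>{x. B.s x = 1}. p \<bullet> x)"
    by (simp add: effective_hamiltonian_def)
  moreover have "esssup M (\<lambda>\<omega>. SUP x. ereal (discrete_hamiltonian \<tau> \<phi> p x \<omega>))
      = esssup M (\<lambda>\<omega>. SUP x. ereal (discrete_hamiltonian \<tau>' \<phi> p x \<omega>))"
    if \<phi>: "\<phi> \<in> test_functions M V" for \<phi>
  proof (rule esssup_AE_cong)
    show "AE \<omega> in M. (SUP x. ereal (discrete_hamiltonian \<tau> \<phi> p x \<omega>))
        = (SUP x. ereal (discrete_hamiltonian \<tau>' \<phi> p x \<omega>))"
      using AE_G by eventually_elim (simp add: discrete_hamiltonian_def \<tau>'_def)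
  qed (intro measurable_SUP_discrete_hamiltonian[OF \<phi>] measurable_weight measurable_\<tau>'; assumption)+
  ultimately show ?thesis
    using B.variational_formula[of p] by (simp cong: INF_cong)
qed

end
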